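(* Let $a$ be a fixed non-negative integer. Then $\mathbb{E}[\mathbf{Y}_n^a]\to\mathbb{E}[\mathbf{Y}^a]$ as $n\to\infty$. In particular, if $\pi\in\mathfrak{S}_n$ is chosen uniformly, then \[ \mathbb{E}[d(\pi)]\to 1+\sum_{d=0}^{\infty}e^{-d^2-d}\quad(\approx 2.13782) \] as $n\to\infty$.
   Context: For $\pi\in\mathfrak{S}_n$ ($n\ge2$), $d(\pi)=\min_{1\le i<j\le n}\big(|i-j|+|\pi(i)-\pi(j)|\big)$. $\mathbf{Y}_n$ is the random variable $d(\pi)$ for $\pi\in\mathfrak{S}_n$ uniform. $\mathbf{Y}$ is the integer-valued random variable with $\Pr{\mathbf{Y}\ge d+2}=e^{-d^2-d}$ for every integer $d\ge0$ (so $\mathbf{Y}\ge2$ almost surely and $\Pr{\mathbf{Y}=d+2}=e^{-d^2-d}-e^{-(d+1)^2-(d+1)}$ for $d\ge0$). *)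

theory Defs
  imports "HOL-Analysis.Analysis" "HOL-Combinatorics.Permutations"
begin

definition perm_dist :: "nat \<Rightarrow> (nat \<Rightarrow> nat) \<Rightarrow> nat" where
  "perm_dist n \<pi> = Min {nat \<bar>int i - int j\<bar> + nat \<bar>int (\<pi> i) - int (\<pi> j)\<bar> | i j.
      i \<in> {1..n} \<and> j \<in> {1..n} \<and> i < j}"

definition moment_Yn :: "nat \<Rightarrow> nat \<Rightarrow> real" where
  "moment_Yn a n = (\<Sum>\<pi>\<in>{\<pi>. \<pi> permutes {1..n}}. real (perm_dist n \<pi>) ^ a)
                     / card {\<pi>. \<pi> permutes {1..n}}"

definition Y_pmf :: "nat \<Rightarrow> real" where
  "Y_pmf k = (if k < 2 then 0 else
     exp (- ((real (k - 2))^2) - real (k - 2)) - exp (- ((real (k - 1))^2) - real (k - 1)))"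

definition moment_Y :: "nat \<Rightarrow> real" where
  "moment_Y a = (\<Sum>k. real k ^ a * Y_pmf k)"

end

theory Submission
  imports Defs "HOL-Probability.Probability" "HOL-Real_Asymp.Real_Asymp"
begin

text \<open>
  Call two points of the grid close if they differ in both coordinates and have distance at most
  d + 1. Then d(\<pi>) \<ge> d + 2 holds iff the graph of \<pi> contains no close pair of points. There are
  asymptotically (d^2 + d) n^2 close pairs, each of which lies in the graph with probability about
  n^-2, and sets of close pairs in which two pairs share a row or a column contribute only O(1/n);
  so the binomial moments of the number of close pairs in the graph converge to those of a Poisson
  variable with mean d^2 + d, and Bonferroni's inequalities give P(d(\<pi>) \<ge> d + 2) \<rightarrow> exp (- d^2 - d).

  For the moments a tail bound uniform in n is needed. Expose the values of \<pi> two at a time. As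
  long as half of the values are unused, the next two values differ by at most d with conditional
  probability at least (d + 1) / (8 n); hence P(d(\<pi>) \<ge> d + 2) decays exponentially in d, and
  Tannery's theorem applies.
\<close>

subsection \<open>Finite sums and limits\<close>

lemma sum_UN_le:
  fixes w :: "'a \<Rightarrow> real"
  assumes "finite I" "\<And>i. i \<in> I \<Longrightarrow> finite (S i)" "\<And>x. 0 \<le> w x"
  shows "sum w (\<Union>i\<in>I. S i) \<le> (\<Sum>i\<in>I. sum w (S i))"
proof -
  have "sum w (\<Union>i\<in>I. S i) = sum w (snd ` (SIGMA i:I. S i))"
    by (rule sum.cong) force+
  also have "\<dots> \<le> (\<Sum>x\<in>(SIGMA i:I. S i). w (snd x))"
    using sum_image_le[of "SIGMA i:I. S i" w snd] assms by (simp add: o_def)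
  also have "\<dots> = (\<Sum>i\<in>I. sum w (S i))"
    using assms by (simp add: sum.Sigma case_prod_unfold)
  finally show ?thesis .
qed

lemma sum_supersets_le:
  fixes w :: "'a set \<Rightarrow> real"
  assumes E: "finite E" and w: "\<And>F. 0 \<le> w F" and c: "0 \<le> c"
    and insert_le: "\<And>F. F \<subseteq> E \<Longrightarrow> card F < m \<Longrightarrow> (\<Sum>e\<in>E. w (insert e F)) \<le> c * w F"
    and G: "G \<subseteq> E"
  shows "(\<Sum>F | F \<subseteq> E \<and> card F = m \<and> G \<subseteq> F. w F) \<le> c ^ (m - card G) * w G"
  using G
proof (induction "m - card G" arbitrary: G)
  case 0
  have "F = G" if "F \<subseteq> E" "card F = m" "G \<subseteq> F" for F
    using card_seteq[of F G] that "0.hyps" E finite_subset by auto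
  then have "{F. F \<subseteq> E \<and> card F = m \<and> G \<subseteq> F} \<subseteq> {G}" by blast
  then have "(\<Sum>F | F \<subseteq> E \<and> card F = m \<and> G \<subseteq> F. w F) \<le> (\<Sum>F\<in>{G}. w F)"
    using w by (intro sum_mono2) auto
  then show ?case using "0.hyps" by simp
next
  case (Suc k)
  define S where "S H = {F. F \<subseteq> E \<and> card F = m \<and> H \<subseteq> F}" for H
  have finG: "finite G" and finS: "finite (S H)" for H
    using Suc.prems E by (auto simp: S_def intro: finite_subset[of _ "Pow E"] finite_subset)
  have "F \<in> (\<Union>e\<in>E - G. S (insert e G))" if "F \<in> S G" for F
  proof -
    have "F \<noteq> G" using that Suc.hyps(2) by (auto simp: S_def)
    then show ?thesis using that by (auto simp: S_def)
  qed
  then have "sum w (S G) \<le> sum w (\<Union>e\<in>E - G. S (insert e G))"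
    using E finS w by (intro sum_mono2) auto
  also have "\<dots> \<le> (\<Sum>e\<in>E - G. sum w (S (insert e G)))"
    using E finS w by (intro sum_UN_le) auto
  also have "\<dots> \<le> (\<Sum>e\<in>E - G. c ^ k * w (insert e G))"
  proof (intro sum_mono)
    fix e assume e: "e \<in> E - G"
    then have "k = m - card (insert e G)" using Suc.hyps(2) finG by simp
    then show "sum w (S (insert e G)) \<le> c ^ k * w (insert e G)"
      using Suc.hyps(1)[of "insert e G"] Suc.prems e by (simp add: S_def)
  qed
  also have "\<dots> \<le> (\<Sum>e\<in>E. c ^ k * w (insert e G))"
    using E w c by (intro sum_mono2) auto
  also have "\<dots> \<le> c ^ k * (c * w G)"
    using insert_le[OF Suc.prems] Suc.hyps(2) c by (simp add: mult_left_mono flip: sum_distrib_left)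
  also have "\<dots> = c ^ (m - card G) * w G" by (simp flip: Suc.hyps(2))
  finally show ?case by (simp add: S_def)
qed

lemma sum_related_subsets_le:
  fixes w :: "'a set \<Rightarrow> real"
  assumes E: "finite E" and w: "\<And>F. 0 \<le> w F" and c: "0 \<le> c"
    and insert_le: "\<And>F. F \<subseteq> E \<Longrightarrow> card F < m \<Longrightarrow> (\<Sum>e\<in>E. w (insert e F)) \<le> c * w F"
  shows "(\<Sum>F | F \<subseteq> E \<and> card F = m \<and> (\<exists>x\<in>F. \<exists>y\<in>F. x \<noteq> y \<and> P x y). w F)
    \<le> c ^ (m - 2) * (\<Sum>x\<in>E. \<Sum>y | y \<in> E \<and> x \<noteq> y \<and> P x y. w {x, y})"
proof -
  define S where "S x y = {F. F \<subseteq> E \<and> card F = m \<and> {x, y} \<subseteq> F}" for x y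
  define R where "R x = {y \<in> E. x \<noteq> y \<and> P x y}" for x
  have finR: "finite (R x)" for x using E by (simp add: R_def)
  have finS: "finite (S x y)" for x y
    using E by (auto simp: S_def intro: finite_subset[of _ "Pow E"])
  have "{F. F \<subseteq> E \<and> card F = m \<and> (\<exists>x\<in>F. \<exists>y\<in>F. x \<noteq> y \<and> P x y)} \<subseteq> (\<Union>x\<in>E. \<Union>y\<in>R x. S x y)"
    by (auto simp: S_def R_def)
  then have "(\<Sum>F | F \<subseteq> E \<and> card F = m \<and> (\<exists>x\<in>F. \<exists>y\<in>F. x \<noteq> y \<and> P x y). w F)
      \<le> sum w (\<Union>x\<in>E. \<Union>y\<in>R x. S x y)"
    using E finR finS w by (intro sum_mono2) auto
  also have "\<dots> \<le> (\<Sum>x\<in>E. \<Sum>y\<in>R x. sum w (S x y))"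
    using E finR finS w by (intro order_trans[OF sum_UN_le] sum_mono sum_UN_le) auto
  also have "\<dots> \<le> (\<Sum>x\<in>E. \<Sum>y\<in>R x. c ^ (m - 2) * w {x, y})"
  proof (intro sum_mono)
    fix x y assume "x \<in> E" "y \<in> R x"
    then show "sum w (S x y) \<le> c ^ (m - 2) * w {x, y}"
      using sum_supersets_le[where m = m and G = "{x, y}", OF E w c insert_le]
      by (simp add: S_def R_def numeral_2_eq_2)
  qed
  finally show ?thesis by (simp add: R_def sum_distrib_left)
qed

lemma fact_diff_div_fact_le:
  assumes "2 * m \<le> n"
  shows "fact (n - m) / fact n \<le> (2 / real n) ^ m"
  using assms
proof (induction m)
  case (Suc m)
  then have "m < n" by simp
  then have "fact (n - m) = (real n - real m) * fact (n - Suc m)"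
    by (metis Suc_diff_Suc fact_Suc of_nat_diff less_imp_le)
  then have "fact (n - Suc m) / fact n = 1 / (real n - real m) * (fact (n - m) / fact n)"
    using \<open>m < n\<close> by simp
  also have "\<dots> \<le> 2 / real n * (2 / real n) ^ m"
  proof (rule mult_mono)
    show "1 / (real n - real m) \<le> 2 / real n"
      using Suc.prems \<open>m < n\<close> by (simp add: field_simps)
  qed (use Suc in auto)
  finally show ?case by simp
qed simp

lemma choose_over_power_tendsto:
  fixes c :: "'a \<Rightarrow> nat" and b :: "'a \<Rightarrow> real"
  assumes "((\<lambda>x. real (c x) / b x) \<longlongrightarrow> L) F" and "filterlim b at_top F"
  shows "((\<lambda>x. real (c x choose j) / b x ^ j) \<longlongrightarrow> L ^ j / fact j) F"
proof -
  have "((\<lambda>x. (\<Prod>i=0..<j. real (c x) / b x - real i * inverse (b x)) / fact j)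
      \<longlongrightarrow> (\<Prod>i=0..<j. L - real i * 0) / fact j) F"
    by (intro tendsto_intros assms tendsto_inverse_0_at_top) simp
  moreover have "(\<Prod>i=0..<j. real (c x) / b x - real i * inverse (b x)) / fact j
      = real (c x choose j) / b x ^ j" for x
  proof -
    have "(\<Prod>i=0..<j. real (c x) / b x - real i * inverse (b x))
        = (\<Prod>i=0..<j. (real (c x) - real i) / b x)"
      by (simp add: left_diff_distrib divide_inverse)
    also have "\<dots> = fact j * real (c x choose j) / b x ^ j"
      by (simp add: prod_dividef binomial_gbinomial gbinomial_prod_rev)
    finally show ?thesis by simp
  qed
  ultimately show ?thesis by simp
qed

lemma choose_times_fact_ratio_tendsto:
  fixes c N :: "'i \<Rightarrow> nat"
  assumes N: "filterlim N at_top F" and c: "((\<lambda>i. real (c i) / real (N i) ^ 2) \<longlongrightarrow> L) F"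
  shows "((\<lambda>i. real (c i choose j) * (fact (N i - 2 * j) / fact (N i))) \<longlongrightarrow> L ^ j / fact j) F"
proof -
  have realN: "filterlim (\<lambda>i. real (N i)) at_top F"
    using filterlim_compose[OF filterlim_real_sequentially N] .
  have pos: "\<forall>\<^sub>F i in F. 2 * j + 1 \<le> N i" using N by (simp add: filterlim_at_top)
  have "((\<lambda>i. real (N i) / real (N i)) \<longlongrightarrow> 1) F"
    using pos by (intro tendsto_eventually) (auto elim: eventually_mono)
  then have N_choose: "((\<lambda>i. real (N i choose (2 * j)) / real (N i) ^ (2 * j))
      \<longlongrightarrow> 1 ^ (2 * j) / fact (2 * j)) F"
    using realN by (rule choose_over_power_tendsto)
  have c_choose: "((\<lambda>i. real (c i choose j) / (real (N i) ^ 2) ^ j) \<longlongrightarrow> L ^ j / fact j) F"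
    using c realN by (intro choose_over_power_tendsto filterlim_pow_at_top) auto
  have "((\<lambda>i. real (c i choose j) / (real (N i) ^ 2) ^ j
        / (fact (2 * j) * (real (N i choose (2 * j)) / real (N i) ^ (2 * j))))
      \<longlongrightarrow> L ^ j / fact j / (fact (2 * j) * (1 ^ (2 * j) / fact (2 * j)))) F"
    by (rule tendsto_divide[OF c_choose tendsto_mult[OF tendsto_const N_choose]]) simp
  moreover have "\<forall>\<^sub>F i in F. real (c i choose j) / (real (N i) ^ 2) ^ j
        / (fact (2 * j) * (real (N i choose (2 * j)) / real (N i) ^ (2 * j)))
      = real (c i choose j) * (fact (N i - 2 * j) / fact (N i))"
    using pos
  proof eventually_elim
    case (elim i)
    then have "real (N i choose (2 * j)) = fact (N i) / (fact (2 * j) * fact (N i - 2 * j))"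
      by (intro binomial_fact) simp
    then show ?case using elim by (simp add: power_mult)
  qed
  ultimately show ?thesis using Lim_transform_eventually by fastforce
qed

lemma exp_alternating_sums:
  "(\<lambda>j. (-1) ^ j * (L ^ j / fact j)) sums exp (- L :: real)"
proof -
  have "(\<lambda>j. (- L) ^ j /\<^sub>R fact j) sums exp (- L)" by (rule exp_converges)
  moreover have "(- L) ^ j /\<^sub>R fact j = (-1) ^ j * (L ^ j / fact j)" for j
    by (simp add: power_minus[of L] divide_inverse mult_ac)
  ultimately show ?thesis by simp
qed

lemma summable_power_times_exp:
  assumes "0 < r"
  shows "summable (\<lambda>k. real k ^ a * exp (s - r * real k))"
proof (rule summable_comparison_test_bigo)
  show "summable (\<lambda>k. norm (1 / real k ^ 2))"
    using inverse_power_summable[of 2, where 'a = real] by (simp add: inverse_eq_divide)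
  show "(\<lambda>k. real k ^ a * exp (s - r * real k)) \<in> O(\<lambda>k. 1 / real k ^ 2)"
    using assms by real_asymp
qed

lemma sums_times_decrement:
  fixes T :: "nat \<Rightarrow> real"
  assumes "summable T" and "(\<lambda>k. real k * T k) \<longlonglongrightarrow> 0"
  shows "(\<lambda>k. real k * (T k - T (Suc k))) sums (\<Sum>k. T (Suc k))"
proof -
  have "(\<lambda>k. real k * T k - real (Suc k) * T (Suc k)) sums 0"
    using telescope_sums'[OF assms(2)] by simp
  moreover have "(\<lambda>k. T (Suc k)) sums (\<Sum>k. T (Suc k))"
    using assms(1) by (intro summable_sums) (simp add: summable_Suc_iff)
  ultimately have "(\<lambda>k. real k * T k - real (Suc k) * T (Suc k) + T (Suc k))
      sums (0 + (\<Sum>k. T (Suc k)))"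
    by (rule sums_add)
  then show ?thesis by (simp add: algebra_simps)
qed

subsection \<open>Binomial moments and the Poisson limit\<close>

lemma expectation_card_choose:
  fixes M :: "'a pmf" and A :: "'b \<Rightarrow> 'a set"
  assumes E: "finite E"
  shows "measure_pmf.expectation M (\<lambda>\<omega>. real (card {e \<in> E. \<omega> \<in> A e} choose j))
    = (\<Sum>F | F \<subseteq> E \<and> card F = j. measure_pmf.prob M (\<Inter>e\<in>F. A e))"
proof -
  define S where "S = {F. F \<subseteq> E \<and> card F = j}"
  have finS: "finite S" using E by (auto simp: S_def intro: finite_subset[of _ "Pow E"])
  have "real (card {e \<in> E. \<omega> \<in> A e} choose j) = (\<Sum>F\<in>S. indicator (\<Inter>e\<in>F. A e) \<omega>)" for \<omega>
  proof -
    have "card {e \<in> E. \<omega> \<in> A e} choose j = card {F \<in> S. \<omega> \<in> (\<Inter>e\<in>F. A e)}"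
      using E by (subst n_subsets[symmetric]) (auto simp: S_def intro!: arg_cong[where f = card])
    then show ?thesis using finS by (simp add: indicator_def sum.If_cases Int_def)
  qed
  moreover have "integrable M (indicator B :: 'a \<Rightarrow> real)" for B
    by (simp add: integrable_indicator_iff measure_pmf.emeasure_eq_measure)
  ultimately show ?thesis by (simp add: S_def)
qed

lemma bonferroni_choose:
  "\<bar>of_bool (x = 0) - (\<Sum>j\<le>m. (-1) ^ j * real (x choose j))\<bar> \<le> real (x choose m)"
proof (cases x)
  case 0
  have "(\<Sum>j\<le>m. (-1) ^ j * real (0 choose j)) = (\<Sum>j\<in>{0}. (-1) ^ j * real (0 choose j))"
    by (intro sum.mono_neutral_right) auto
  then show ?thesis using 0 by simp
next
  case (Suc y)
  have "(\<Sum>j\<le>m. (-1) ^ j * real (x choose j)) = (-1) ^ m * real (y choose m)"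
    using gbinomial_sum_lower_neg[of "real x" m] Suc by (simp add: binomial_gbinomial mult.commute)
  moreover have "y choose m \<le> x choose m" using Suc by (intro binomial_right_mono) simp
  ultimately show ?thesis using Suc by (simp add: abs_mult)
qed

lemma prob_eq_0_bonferroni:
  fixes M :: "'a pmf" and X :: "'a \<Rightarrow> nat"
  defines "\<beta> \<equiv> \<lambda>j. measure_pmf.expectation M (\<lambda>\<omega>. real (X \<omega> choose j))"
  assumes int: "\<And>j. integrable M (\<lambda>\<omega>. real (X \<omega> choose j))"
  shows "\<bar>measure_pmf.prob M {\<omega>. X \<omega> = 0} - (\<Sum>j\<le>m. (-1) ^ j * \<beta> j)\<bar> \<le> \<beta> m"
proof -
  define D where "D \<omega> = indicator {\<omega>. X \<omega> = 0} \<omega> - (\<Sum>j\<le>m. (-1) ^ j * real (X \<omega> choose j))" for \<omega>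
  have ind: "integrable M (indicator {\<omega>. X \<omega> = 0} :: 'a \<Rightarrow> real)"
    by (simp add: integrable_indicator_iff measure_pmf.emeasure_eq_measure)
  have intD: "integrable M D" unfolding D_def using int ind by simp
  have "measure_pmf.prob M {\<omega>. X \<omega> = 0} - (\<Sum>j\<le>m. (-1) ^ j * \<beta> j) = measure_pmf.expectation M D"
    unfolding D_def \<beta>_def using int ind by (subst Bochner_Integration.integral_diff) auto
  also have "\<bar>\<dots>\<bar> \<le> measure_pmf.expectation M (\<lambda>\<omega>. \<bar>D \<omega>\<bar>)" by (rule integral_abs_bound)
  also have "\<dots> \<le> \<beta> m"
    unfolding \<beta>_def
  proof (intro integral_mono integrable_abs intD int)
    show "\<bar>D \<omega>\<bar> \<le> real (X \<omega> choose m)" for \<omega>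
      using bonferroni_choose[of "X \<omega>" m] by (simp add: D_def indicator_def of_bool_def)
  qed
  finally show ?thesis .
qed

lemma prob_eq_0_tendsto_exp:
  fixes M :: "'i \<Rightarrow> 'a pmf" and X :: "'i \<Rightarrow> 'a \<Rightarrow> nat" and L :: real
  assumes int: "\<And>i j. integrable (M i) (\<lambda>\<omega>. real (X i \<omega> choose j))"
    and moments: "\<And>j. ((\<lambda>i. measure_pmf.expectation (M i) (\<lambda>\<omega>. real (X i \<omega> choose j)))
      \<longlongrightarrow> L ^ j / fact j) F"
  shows "((\<lambda>i. measure_pmf.prob (M i) {\<omega>. X i \<omega> = 0}) \<longlongrightarrow> exp (- L)) F"
proof (rule tendstoI)
  fix \<epsilon> :: real assume "\<epsilon> > 0"
  define \<beta> where "\<beta> i j = measure_pmf.expectation (M i) (\<lambda>\<omega>. real (X i \<omega> choose j))" for i j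
  define s where "s m = (\<Sum>j\<le>m. (-1) ^ j * (L ^ j / fact j))" for m
  have "s \<longlonglongrightarrow> exp (- L)" using exp_alternating_sums[of L] unfolding s_def sums_def_le .
  moreover have "(\<lambda>m. L ^ m / fact m) \<longlonglongrightarrow> 0"
    using summable_LIMSEQ_zero[OF summable_exp[of L]] by (simp add: divide_inverse mult.commute)
  ultimately have "\<forall>\<^sub>F m in sequentially. dist (s m) (exp (- L)) < \<epsilon> / 4 \<and> L ^ m / fact m < \<epsilon> / 4"
    using \<open>\<epsilon> > 0\<close> by (intro eventually_conj tendstoD[of s] order_tendstoD(2)[of _ 0]) auto
  then obtain m where m: "dist (s m) (exp (- L)) < \<epsilon> / 4" "L ^ m / fact m < \<epsilon> / 4"
    using eventually_happens[of _ sequentially] by auto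
  have "((\<lambda>i. \<Sum>j\<le>m. (-1) ^ j * \<beta> i j) \<longlongrightarrow> s m) F"
    unfolding s_def \<beta>_def by (intro tendsto_intros moments)
  then have "\<forall>\<^sub>F i in F. dist (\<Sum>j\<le>m. (-1) ^ j * \<beta> i j) (s m) < \<epsilon> / 4"
    using \<open>\<epsilon> > 0\<close> by (intro tendstoD) auto
  moreover have "\<forall>\<^sub>F i in F. \<beta> i m < \<epsilon> / 4"
    using moments m(2) unfolding \<beta>_def by (rule order_tendstoD(2))
  ultimately show "\<forall>\<^sub>F i in F. dist (measure_pmf.prob (M i) {\<omega>. X i \<omega> = 0}) (exp (- L)) < \<epsilon>"
  proof eventually_elim
    case (elim i)
    have "\<bar>measure_pmf.prob (M i) {\<omega>. X i \<omega> = 0} - (\<Sum>j\<le>m. (-1) ^ j * \<beta> i j)\<bar> \<le> \<beta> i m"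
      unfolding \<beta>_def by (rule prob_eq_0_bonferroni[OF int])
    then show ?case using elim m(1) \<open>\<epsilon> > 0\<close> unfolding dist_real_def by linarith
  qed
qed

subsection \<open>Moments from tails\<close>

lemma expectation_nat_pmf_sums:
  fixes f :: "nat \<Rightarrow> real"
  assumes "summable (\<lambda>k. \<bar>f k\<bar> * pmf p k)"
  shows "(\<lambda>k. f k * pmf p k) sums measure_pmf.expectation p f"
proof -
  have "integrable (count_space UNIV) (\<lambda>k. f k * pmf p k)"
    using assms by (simp add: integrable_count_space_nat_iff abs_mult)
  then have "(\<lambda>k. f k * pmf p k) sums integral\<^sup>L (count_space UNIV) (\<lambda>k. f k * pmf p k)"
    by (rule sums_integral_count_space_nat)
  then show ?thesis by (simp add: measure_pmf_eq_density integral_density mult.commute)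
qed

lemma pmf_eq_tail_diff: "pmf p k = measure_pmf.prob p {k..} - measure_pmf.prob p {Suc k..}"
proof -
  have "{k..} = insert k {Suc k..}" by auto
  then show ?thesis
    by (simp add: measure_pmf.finite_measure_Union[of "{k}", simplified] measure_pmf_single)
qed

lemma expectation_tendsto_of_tails:
  fixes p :: "'i \<Rightarrow> nat pmf" and f g T :: "nat \<Rightarrow> real"
  assumes F: "F \<noteq> bot"
    and tails: "\<And>k. ((\<lambda>n. measure_pmf.prob (p n) {k..}) \<longlongrightarrow> T k) F"
    and bound: "\<forall>\<^sub>F n in F. \<forall>k. measure_pmf.prob (p n) {k..} \<le> g k"
    and summable: "summable (\<lambda>k. \<bar>f k\<bar> * g k)"
  shows "((\<lambda>n. measure_pmf.expectation (p n) f) \<longlongrightarrow> (\<Sum>k. f k * (T k - T (Suc k)))) F"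
proof -
  have pmf_bound: "\<forall>\<^sub>F n in F. \<forall>k. norm (f k * pmf (p n) k) \<le> \<bar>f k\<bar> * g k"
    using bound
  proof eventually_elim
    case (elim n)
    have "pmf (p n) k \<le> g k" for k
      using elim[rule_format, of k] measure_nonneg[of "p n" "{Suc k..}"]
      unfolding pmf_eq_tail_diff by linarith
    then show ?case by (simp add: abs_mult mult_left_mono)
  qed
  have "((\<lambda>n. \<Sum>k. f k * pmf (p n) k) \<longlongrightarrow> (\<Sum>k. f k * (T k - T (Suc k)))) F"
  proof (rule tannerys_theorem[THEN conjunct2, THEN conjunct2])
    show "((\<lambda>n. f k * pmf (p n) k) \<longlongrightarrow> f k * (T k - T (Suc k))) F" for k
      unfolding pmf_eq_tail_diff by (intro tendsto_intros tails)
    show "\<forall>\<^sub>F (k, n) in sequentially \<times>\<^sub>F F. norm (f k * pmf (p n) k) \<le> \<bar>f k\<bar> * g k"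
      using eventually_prodI[of "\<lambda>_. True" sequentially, OF _ pmf_bound]
      by (simp add: case_prod_unfold eventually_mono)
  qed (use summable F in auto)
  moreover have "\<forall>\<^sub>F n in F. (\<Sum>k. f k * pmf (p n) k) = measure_pmf.expectation (p n) f"
    using pmf_bound
  proof eventually_elim
    case (elim n)
    then have "summable (\<lambda>k. \<bar>f k\<bar> * pmf (p n) k)"
      by (intro summable_comparison_test'[OF summable]) (simp add: abs_mult)
    then show ?case by (simp add: sums_unique[OF expectation_nat_pmf_sums])
  qed
  ultimately show ?thesis by (rule Lim_transform_eventually)
qed

subsection \<open>Permutations extending a partial permutation\<close>

abbreviation perms :: "'a set \<Rightarrow> ('a \<Rightarrow> 'a) set" where
  "perms A \<equiv> {\<pi>. \<pi> permutes A}"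

definition partial_perm :: "'a set \<Rightarrow> ('a \<times> 'a) set \<Rightarrow> bool" where
  "partial_perm A V \<longleftrightarrow> V \<subseteq> A \<times> A \<and> inj_on fst V \<and> inj_on snd V"

definition extensions :: "('a \<times> 'b) set \<Rightarrow> ('a \<Rightarrow> 'b) set" where
  "extensions V = {f. \<forall>p\<in>V. f (fst p) = snd p}"

lemma extensions_Union: "extensions (\<Union>F) = (\<Inter>e\<in>F. extensions e)"
  by (auto simp: extensions_def)

lemma partial_perm_finite: "finite A \<Longrightarrow> partial_perm A V \<Longrightarrow> finite V"
  unfolding partial_perm_def by (meson finite_SigmaI finite_subset)

lemma partial_perm_if_extension:
  assumes "\<pi> \<in> extensions V" "\<pi> permutes A" "V \<subseteq> A \<times> A"
  shows "partial_perm A V"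
proof -
  have eq: "snd p = \<pi> (fst p)" if "p \<in> V" for p
    using assms(1) that by (simp add: extensions_def)
  have "inj_on fst V" by (rule inj_onI) (simp add: prod_eq_iff eq)
  moreover have "inj_on snd V"
    by (rule inj_onI) (simp add: prod_eq_iff eq inj_eq[OF permutes_inj[OF assms(2)]])
  ultimately show ?thesis using assms(3) by (simp add: partial_perm_def)
qed

lemma partial_perm_insert:
  assumes "finite A" "partial_perm A V" "i \<in> A - fst ` V" "u \<in> A - snd ` V"
  shows "partial_perm A (insert (i, u) V)" and "card (insert (i, u) V) = card V + 1"
proof -
  show "partial_perm A (insert (i, u) V)"
    using assms(2-4) by (auto simp: partial_perm_def inj_on_insert)
  have "(i, u) \<notin> V" using assms(3) by force
  then show "card (insert (i, u) V) = card V + 1"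
    using partial_perm_finite[OF assms(1,2)] by simp
qed

lemma card_unused_values:
  assumes "finite A" "partial_perm A V"
  shows "card (A - snd ` V) = card A - card V"
proof -
  have "snd ` V \<subseteq> A" "card (snd ` V) = card V"
    using assms(2) by (auto simp: partial_perm_def card_image)
  then show ?thesis using assms(1) by (simp add: card_Diff_subset finite_subset)
qed

lemma permutes_extension_unused:
  assumes "\<pi> permutes A" "\<pi> \<in> extensions V" "i \<in> A" "i \<notin> fst ` V"
  shows "\<pi> i \<in> A - snd ` V"
proof -
  have "snd p \<noteq> \<pi> i" if "p \<in> V" for p
  proof -
    have "fst p \<noteq> i" using assms(4) that by blast
    moreover have "snd p = \<pi> (fst p)" using assms(2) that by (simp add: extensions_def)
    ultimately show ?thesis using permutes_inj[OF assms(1)] by (simp add: inj_eq)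
  qed
  then show ?thesis using assms(3) permutes_in_image[OF assms(1)] by fastforce
qed

lemma ex_perm_extension:
  assumes A: "finite A" and V: "partial_perm A V"
  shows "\<exists>\<sigma>. \<sigma> permutes A \<and> \<sigma> \<in> extensions V"
proof -
  have inj: "inj_on fst V" "inj_on snd V" and sub: "fst ` V \<subseteq> A" "snd ` V \<subseteq> A"
    using V by (auto simp: partial_perm_def)
  define f where "f = snd \<circ> the_inv_into V fst"
  have f: "f (fst p) = snd p" if "p \<in> V" for p
    using that inj by (simp add: f_def the_inv_into_f_f)
  have "bij_betw (the_inv_into V fst) (fst ` V) V"
    using inj by (intro bij_betw_the_inv_into) (simp add: bij_betw_def)
  then have bij_f: "bij_betw f (fst ` V) (snd ` V)"
    unfolding f_def by (rule bij_betw_trans) (use inj in \<open>simp add: bij_betw_def\<close>)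
  have "card (A - fst ` V) = card (A - snd ` V)"
    using A sub inj by (simp add: card_Diff_subset finite_subset card_image)
  then obtain g where bij_g: "bij_betw g (A - fst ` V) (A - snd ` V)"
    using A finite_same_card_bij[of "A - fst ` V" "A - snd ` V"] by auto
  define \<sigma> where "\<sigma> x = (if x \<in> fst ` V then f x else if x \<in> A then g x else x)" for x
  have "bij_betw \<sigma> (fst ` V \<union> (A - fst ` V)) (snd ` V \<union> (A - snd ` V))"
  proof (rule bij_betw_combine)
    show "bij_betw \<sigma> (fst ` V) (snd ` V)"
      using bij_f by (rule bij_betw_cong[THEN iffD1, rotated]) (simp add: \<sigma>_def)
    show "bij_betw \<sigma> (A - fst ` V) (A - snd ` V)"
      using bij_g by (rule bij_betw_cong[THEN iffD1, rotated]) (simp add: \<sigma>_def)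
  qed auto
  then have "bij_betw \<sigma> A A" using sub by (simp add: Un_absorb1)
  then have "\<sigma> permutes A"
    by (rule bij_imp_permutes) (use sub in \<open>auto simp: \<sigma>_def\<close>)
  moreover have "\<sigma> \<in> extensions V" by (simp add: extensions_def \<sigma>_def f)
  ultimately show ?thesis by blast
qed

lemma card_perm_extensions:
  assumes A: "finite A" and V: "partial_perm A V"
  shows "card (perms A \<inter> extensions V) = fact (card A - card V)"
proof -
  obtain \<sigma> where \<sigma>: "\<sigma> permutes A" "\<sigma> \<in> extensions V"
    using ex_perm_extension[OF A V] by blast
  have fixes_iff: "\<sigma> \<circ> \<rho> \<in> extensions V \<longleftrightarrow> (\<forall>x\<in>fst ` V. \<rho> x = x)" for \<rho>
  proof -
    have "snd p = \<sigma> (fst p)" if "p \<in> V" for p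
      using \<sigma>(2) that by (simp add: extensions_def)
    then show ?thesis by (simp add: extensions_def inj_eq[OF permutes_inj[OF \<sigma>(1)]])
  qed
  have sub: "fst ` V \<subseteq> A" using V by (auto simp: partial_perm_def)
  have perms_Diff: "perms (A - fst ` V) = {\<rho> \<in> perms A. \<forall>x\<in>fst ` V. \<rho> x = x}"
    by (auto intro: permutes_subset permutes_not_in permutes_superset)
  have "bij_betw ((\<circ>) \<sigma>) (perms (A - fst ` V)) (perms A \<inter> extensions V)"
  proof (rule bij_betw_byWitness[where f' = "(\<circ>) (inv \<sigma>)"])
    show "(\<circ>) \<sigma> ` perms (A - fst ` V) \<subseteq> perms A \<inter> extensions V"
      using \<sigma>(1) unfolding perms_Diff by (auto simp: fixes_iff permutes_compose)
    have "\<forall>x\<in>fst ` V. (inv \<sigma> \<circ> \<pi>) x = x" if "\<pi> \<in> extensions V" for \<pi>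
      using that permutes_inv_o(1)[OF \<sigma>(1)] by (simp only: fixes_iff[symmetric] o_assoc id_comp)
    then show "(\<circ>) (inv \<sigma>) ` (perms A \<inter> extensions V) \<subseteq> perms (A - fst ` V)"
      using \<sigma>(1) unfolding perms_Diff
      by (intro image_subsetI) (simp add: permutes_compose permutes_inv)
  qed (use permutes_inv_o[OF \<sigma>(1)] in \<open>auto simp: o_assoc\<close>)
  then have "card (perms A \<inter> extensions V) = card (perms (A - fst ` V))"
    by (rule bij_betw_same_card[symmetric])
  also have "\<dots> = fact (card (A - fst ` V))"
    using A by (intro card_permutations) auto
  also have "card (A - fst ` V) = card A - card V"
    using A V sub by (simp add: card_Diff_subset finite_subset card_image partial_perm_def)
  finally show ?thesis .
qed

lemma card_perm_extensions_le:
  assumes "finite A" "V \<subseteq> A \<times> A"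
  shows "card (perms A \<inter> extensions V) \<le> fact (card A - card V)"
proof (cases "perms A \<inter> extensions V = {}")
  case False
  then show ?thesis using assms partial_perm_if_extension card_perm_extensions by fastforce
qed simp

definition uniform_perm :: "'a set \<Rightarrow> ('a \<Rightarrow> 'a) pmf" where
  "uniform_perm A = pmf_of_set (perms A)"

lemma perms_nonempty: "perms A \<noteq> {}"
  using permutes_id by blast

lemma prob_uniform_perm:
  "finite A \<Longrightarrow> measure_pmf.prob (uniform_perm A) S = real (card (perms A \<inter> S)) / fact (card A)"
  by (simp add: uniform_perm_def measure_pmf_of_set[OF perms_nonempty] finite_permutations
      card_permutations)

lemma integrable_uniform_perm:
  fixes f :: "('a \<Rightarrow> 'a) \<Rightarrow> real"
  shows "finite A \<Longrightarrow> integrable (uniform_perm A) f"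
  unfolding uniform_perm_def
  by (intro integrable_measure_pmf_finite)
     (simp add: set_pmf_of_set[OF perms_nonempty] finite_permutations)

lemma prob_extensions_le:
  assumes A: "finite A" and V: "V \<subseteq> A \<times> A" "2 * card V \<le> card A"
  shows "measure_pmf.prob (uniform_perm A) (extensions V) \<le> (2 / card A) ^ card V"
proof -
  have "real (card (perms A \<inter> extensions V)) \<le> real (fact (card A - card V))"
    unfolding of_nat_le_iff using A V(1) by (rule card_perm_extensions_le)
  then have "measure_pmf.prob (uniform_perm A) (extensions V)
      \<le> fact (card A - card V) / fact (card A)"
    using A by (simp add: prob_uniform_perm divide_right_mono)
  also have "\<dots> \<le> (2 / card A) ^ card V" using V(2) by (rule fact_diff_div_fact_le)
  finally show ?thesis .
qed

definition binomial_moment :: "'a set \<Rightarrow> ('a \<times> 'a) set set \<Rightarrow> nat \<Rightarrow> real" where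
  "binomial_moment A E j
    = (\<Sum>F | F \<subseteq> E \<and> card F = j. measure_pmf.prob (uniform_perm A) (extensions (\<Union>F)))"

lemma expectation_choose_eq_binomial_moment:
  "finite E \<Longrightarrow> measure_pmf.expectation (uniform_perm A)
      (\<lambda>\<pi>. real (card {e \<in> E. \<pi> \<in> extensions e} choose j)) = binomial_moment A E j"
  by (simp add: expectation_card_choose binomial_moment_def extensions_Union)

subsection \<open>Families of pairs of bounded degree\<close>

definition share_line :: "('a \<times> 'b) set \<Rightarrow> ('a \<times> 'b) set \<Rightarrow> bool" where
  "share_line e e' \<longleftrightarrow> (\<exists>p\<in>e. \<exists>p'\<in>e'. fst p = fst p' \<or> snd p = snd p')"

locale pair_family =
  fixes A :: "'a set" and E :: "('a \<times> 'a) set set" and K :: nat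
  assumes finite_ground: "finite A"
    and partial_perm_pair: "e \<in> E \<Longrightarrow> partial_perm A e"
    and card_pair: "e \<in> E \<Longrightarrow> card e = 2"
    and degree_le: "card {e \<in> E. p \<in> e} \<le> K"
begin

lemma pair_subset: "e \<in> E \<Longrightarrow> e \<subseteq> A \<times> A"
  using partial_perm_pair by (simp add: partial_perm_def)

lemma finite_pair: "e \<in> E \<Longrightarrow> finite e"
  using finite_ground partial_perm_pair by (rule partial_perm_finite)

lemma finite_family: "finite E"
  by (rule finite_subset[of _ "Pow (A \<times> A)"]) (use pair_subset finite_ground in auto)

lemma finite_Union_pairs: "F \<subseteq> E \<Longrightarrow> finite (\<Union>F)"
  using finite_family finite_pair by (auto intro: finite_subset)

lemma card_Union_pairs_le:
  assumes "F \<subseteq> E"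
  shows "card (\<Union>F) \<le> 2 * card F"
proof -
  have "card (\<Union>F) \<le> sum card F" by (rule card_Union_le_sum_card)
  also have "\<dots> = (\<Sum>e\<in>F. 2)" using assms by (intro sum.cong) (auto intro: card_pair)
  finally show ?thesis by simp
qed

lemma card_meeting_le:
  assumes "finite P"
  shows "card {e \<in> E. e \<inter> P \<noteq> {}} \<le> card P * K"
proof -
  have "{e \<in> E. e \<inter> P \<noteq> {}} = (\<Union>p\<in>P. {e \<in> E. p \<in> e})" by auto
  then have "card {e \<in> E. e \<inter> P \<noteq> {}} \<le> (\<Sum>p\<in>P. card {e \<in> E. p \<in> e})"
    using card_UN_le[OF assms] by metis
  also have "\<dots> \<le> (\<Sum>p\<in>P. K)" by (intro sum_mono degree_le)
  finally show ?thesis by simp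
qed

lemma card_family_le: "card E \<le> card A ^ 2 * K"
proof -
  have "e \<inter> (A \<times> A) \<noteq> {}" if "e \<in> E" for e
    using pair_subset[OF that] card_pair[OF that] by (auto simp: inf_absorb1)
  then have "{e \<in> E. e \<inter> (A \<times> A) \<noteq> {}} = E" by blast
  then show ?thesis
    using card_meeting_le[of "A \<times> A"] finite_ground
    by (simp add: card_cartesian_product power2_eq_square)
qed

lemma card_share_line_le:
  assumes e: "e \<in> E"
  shows "card {e' \<in> E. share_line e e'} \<le> 4 * card A * K"
proof -
  define P where "P = fst ` e \<times> A \<union> A \<times> snd ` e"
  have fin: "finite P" using finite_pair[OF e] finite_ground by (simp add: P_def)
  have "e' \<inter> P \<noteq> {}" if e': "e' \<in> E" "share_line e e'" for e'
  proof -
    obtain p p' where p: "p \<in> e" "p' \<in> e'" "fst p = fst p' \<or> snd p = snd p'"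
      using e'(2) unfolding share_line_def by blast
    moreover have "p' \<in> A \<times> A" using pair_subset[OF e'(1)] p(2) by blast
    ultimately have "p' \<in> P" by (auto simp: P_def mem_Times_iff intro: rev_image_eqI)
    then show ?thesis using p(2) by blast
  qed
  then have "card {e' \<in> E. share_line e e'} \<le> card {e' \<in> E. e' \<inter> P \<noteq> {}}"
    using finite_family by (intro card_mono) auto
  also have "\<dots> \<le> card P * K" using fin by (rule card_meeting_le)
  also have "\<dots> \<le> 4 * card A * K"
  proof (rule mult_right_mono)
    have "card P \<le> card (fst ` e) * card A + card A * card (snd ` e)"
      unfolding P_def by (rule order_trans[OF card_Un_le]) (simp add: card_cartesian_product)
    also have "\<dots> \<le> 2 * card A + card A * 2"
      using card_image_le[OF finite_pair[OF e]] card_pair[OF e] by (intro add_mono mult_mono) auto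
    finally show "card P \<le> 4 * card A" by simp
  qed simp
  finally show ?thesis .
qed

text \<open>Up to a constant factor, the weight of W bounds the probability that a permutation extends W.\<close>

definition weight :: "('a \<times> 'a) set \<Rightarrow> real" where
  "weight W = (1 / card A) ^ card W"

lemma weight_nonneg: "0 \<le> weight W"
  by (simp add: weight_def)

lemma weight_le: "c \<le> card W \<Longrightarrow> weight W \<le> (1 / card A) ^ c"
  unfolding weight_def by (rule power_decreasing) (auto simp: divide_le_eq_1)

lemma sum_weight_Un_le:
  assumes V: "finite V"
  shows "(\<Sum>e\<in>E. weight (V \<union> e)) \<le> real ((card V + 1) * K) * weight V"
proof -
  define n where "n = real (card A)"
  have "weight (V \<union> e) \<le> of_bool (e \<inter> V \<noteq> {}) * weight V + weight V / n ^ 2" if e: "e \<in> E" for e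
  proof (cases "e \<inter> V = {}")
    case True
    then have "card (V \<union> e) = card V + 2"
      using V finite_pair[OF e] card_pair[OF e] by (subst card_Un_disjoint) auto
    then show ?thesis
      using True
      by (simp add: weight_def n_def power_add power_divide power2_eq_square mult_ac)
  next
    case False
    have "card V \<le> card (V \<union> e)" using V finite_pair[OF e] by (intro card_mono) auto
    then have "weight (V \<union> e) \<le> weight V" using weight_le by (simp add: weight_def)
    then show ?thesis using False weight_nonneg[of V] by (simp add: add_increasing2)
  qed
  then have "(\<Sum>e\<in>E. weight (V \<union> e)) \<le> (\<Sum>e\<in>E. of_bool (e \<inter> V \<noteq> {}) * weight V + weight V / n ^ 2)"
    by (rule sum_mono)
  also have "\<dots> = real (card {e \<in> E. e \<inter> V \<noteq> {}}) * weight V + real (card E) * (weight V / n ^ 2)"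
    using finite_family by (simp add: sum.distrib Int_def flip: sum_distrib_right)
  also have "\<dots> \<le> real (card V * K) * weight V + real (card A ^ 2 * K) * (weight V / n ^ 2)"
    using card_meeting_le[OF V] card_family_le weight_nonneg[of V]
    by (intro add_mono mult_right_mono of_nat_mono) auto
  also have "\<dots> \<le> real ((card V + 1) * K) * weight V"
    using weight_nonneg[of V] by (cases "n = 0") (simp_all add: n_def algebra_simps)
  finally show ?thesis .
qed

lemma weight_Un_pair_le:
  assumes e: "e \<in> E" "e' \<in> E" "e \<noteq> e'"
  shows "weight (e \<union> e') \<le> of_bool (e' \<inter> e \<noteq> {}) / real (card A) ^ 3 + 1 / real (card A) ^ 4"
proof -
  have fin: "finite e" "finite e'" and card: "card e = 2" "card e' = 2"
    using e finite_pair card_pair by auto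
  show ?thesis
  proof (cases "e' \<inter> e = {}")
    case True
    then have "card (e \<union> e') = 4" using fin card by (subst card_Un_disjoint) auto
    then show ?thesis using True by (simp add: weight_def power_divide)
  next
    case False
    have "\<not> e' \<subseteq> e" using card_seteq[of e e'] fin card e(3) by auto
    then have "card e < card (e \<union> e')" using fin by (intro psubset_card_mono) auto
    then have "weight (e \<union> e') \<le> (1 / card A) ^ 3" using card by (intro weight_le) simp
    then show ?thesis using False by (simp add: power_divide add_increasing2)
  qed
qed

lemma sum_weight_share_line_le:
  assumes e: "e \<in> E"
  shows "(\<Sum>e' | e' \<in> E \<and> e \<noteq> e' \<and> share_line e e'. weight (e \<union> e'))
    \<le> 6 * real K / real (card A) ^ 3"
proof -
  define n where "n = real (card A)"
  define S where "S = {e' \<in> E. e \<noteq> e' \<and> share_line e e'}"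
  have finS: "finite S" using finite_family by (simp add: S_def)
  have "(\<Sum>e'\<in>S. weight (e \<union> e')) \<le> (\<Sum>e'\<in>S. of_bool (e' \<inter> e \<noteq> {}) / n ^ 3 + 1 / n ^ 4)"
  proof (rule sum_mono)
    fix e' assume "e' \<in> S"
    then have "e' \<in> E" "e \<noteq> e'" by (simp_all add: S_def)
    then show "weight (e \<union> e') \<le> of_bool (e' \<inter> e \<noteq> {}) / n ^ 3 + 1 / n ^ 4"
      unfolding n_def by (rule weight_Un_pair_le[OF e])
  qed
  also have "\<dots> = real (card {e' \<in> S. e' \<inter> e \<noteq> {}}) / n ^ 3 + real (card S) / n ^ 4"
    using finS by (simp add: sum.distrib Int_def flip: sum_divide_distrib)
  also have "\<dots> \<le> real (2 * K) / n ^ 3 + real (4 * card A * K) / n ^ 4"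
  proof (intro add_mono divide_right_mono of_nat_mono)
    have "card {e' \<in> S. e' \<inter> e \<noteq> {}} \<le> card {e' \<in> E. e' \<inter> e \<noteq> {}}"
      using finite_family by (intro card_mono) (auto simp: S_def)
    also have "\<dots> \<le> 2 * K" using card_meeting_le[OF finite_pair[OF e]] card_pair[OF e] by simp
    finally show "card {e' \<in> S. e' \<inter> e \<noteq> {}} \<le> 2 * K" .
    have "card S \<le> card {e' \<in> E. share_line e e'}"
      using finite_family by (intro card_mono) (auto simp: S_def)
    then show "card S \<le> 4 * card A * K" using card_share_line_le[OF e] by simp
  qed (simp_all add: n_def)
  also have "\<dots> = 6 * real K / n ^ 3"
    by (cases "n = 0") (simp_all add: n_def field_simps eval_nat_numeral)
  finally show ?thesis by (simp add: S_def n_def)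
qed

lemma sum_weight_share_line_subsets_le:
  "(\<Sum>F | F \<subseteq> E \<and> card F = j \<and> (\<exists>e\<in>F. \<exists>e'\<in>F. e \<noteq> e' \<and> share_line e e'). weight (\<Union>F))
    \<le> real ((2 * j + 1) * K) ^ (j - 2) * (6 * real K ^ 2 / real (card A))"
proof -
  define n where "n = real (card A)"
  define c where "c = real ((2 * j + 1) * K)"
  have insert_le: "(\<Sum>e\<in>E. weight (\<Union>(insert e F))) \<le> c * weight (\<Union>F)"
    if F: "F \<subseteq> E" "card F < j" for F
  proof -
    have "(\<Sum>e\<in>E. weight (\<Union>(insert e F))) \<le> real ((card (\<Union>F) + 1) * K) * weight (\<Union>F)"
      using sum_weight_Un_le[OF finite_Union_pairs[OF F(1)]] by (simp add: Un_commute)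
    also have "\<dots> \<le> c * weight (\<Union>F)"
      unfolding c_def using card_Union_pairs_le[OF F(1)] F(2) weight_nonneg
      by (intro mult_right_mono of_nat_mono mult_mono) auto
    finally show ?thesis .
  qed
  have "(\<Sum>F | F \<subseteq> E \<and> card F = j \<and> (\<exists>e\<in>F. \<exists>e'\<in>F. e \<noteq> e' \<and> share_line e e'). weight (\<Union>F))
      \<le> c ^ (j - 2) * (\<Sum>e\<in>E. \<Sum>e' | e' \<in> E \<and> e \<noteq> e' \<and> share_line e e'. weight (\<Union>{e, e'}))"
    by (rule sum_related_subsets_le)
       (use finite_family weight_nonneg insert_le in \<open>auto simp: c_def\<close>)
  also have "\<dots> \<le> c ^ (j - 2) * (\<Sum>e\<in>E. 6 * real K / n ^ 3)"
    using sum_weight_share_line_le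
    by (intro mult_left_mono sum_mono) (auto simp: n_def c_def)
  also have "\<dots> \<le> c ^ (j - 2) * (real (card A ^ 2 * K) * (6 * real K / n ^ 3))"
    unfolding sum_constant using card_family_le
    by (intro mult_left_mono mult_right_mono of_nat_mono) (auto simp: c_def n_def)
  also have "\<dots> = c ^ (j - 2) * (6 * real K ^ 2 / n)"
    by (cases "n = 0") (simp_all add: n_def field_simps eval_nat_numeral)
  finally show ?thesis by (simp add: c_def n_def)
qed

lemma prob_extensions_separated:
  assumes F: "F \<subseteq> E" and separated: "\<And>e e'. e \<in> F \<Longrightarrow> e' \<in> F \<Longrightarrow> e \<noteq> e' \<Longrightarrow> \<not> share_line e e'"
  shows "measure_pmf.prob (uniform_perm A) (extensions (\<Union>F))
    = fact (card A - 2 * card F) / fact (card A)"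
proof -
  have eqI: "p = p'" if p: "p \<in> \<Union>F" "p' \<in> \<Union>F" "fst p = fst p' \<or> snd p = snd p'" for p p'
  proof -
    obtain e e' where e: "e \<in> F" "p \<in> e" "e' \<in> F" "p' \<in> e'" using p(1,2) by blast
    then have "e = e'" using separated p(3) unfolding share_line_def by blast
    moreover have "partial_perm A e" using e F partial_perm_pair by blast
    ultimately show ?thesis using e p(3) by (auto simp: partial_perm_def dest: inj_onD)
  qed
  have "\<Union>F \<subseteq> A \<times> A" using F pair_subset by blast
  then have partial: "partial_perm A (\<Union>F)"
    unfolding partial_perm_def inj_on_def using eqI by blast
  have "card (\<Union>F) = sum card F"
  proof (rule card_Union_disjoint)
    show "disjoint F" using separated unfolding pairwise_def disjnt_def share_line_def by blast
  qed (use F finite_pair in blast)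
  also have "\<dots> = (\<Sum>e\<in>F. 2)" using F by (intro sum.cong) (auto intro: card_pair)
  finally show ?thesis
    using card_perm_extensions[OF finite_ground partial]
    by (simp add: prob_uniform_perm finite_ground mult.commute)
qed

lemma abs_prob_extensions_diff_le:
  assumes F: "F \<subseteq> E" "card F = j" and A: "4 * j \<le> card A"
  shows "\<bar>measure_pmf.prob (uniform_perm A) (extensions (\<Union>F))
    - fact (card A - 2 * j) / fact (card A)\<bar> \<le> 4 ^ j * weight (\<Union>F)"
proof -
  define P where "P = measure_pmf.prob (uniform_perm A) (extensions (\<Union>F))"
  define q :: real where "q = fact (card A - 2 * j) / fact (card A)"
  have card: "card (\<Union>F) \<le> 2 * j" using card_Union_pairs_le[OF F(1)] F(2) by simp
  have weight_ge: "(2 / card A) ^ c \<le> 4 ^ j * weight (\<Union>F)" if c: "card (\<Union>F) \<le> c" "c \<le> 2 * j" for c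
  proof -
    have "(2 / card A) ^ c = 2 ^ c * (1 / card A) ^ c" by (simp add: power_divide)
    also have "\<dots> \<le> 2 ^ (2 * j) * weight (\<Union>F)"
      unfolding weight_def using c
      by (intro mult_mono power_increasing power_decreasing) (auto simp: divide_le_eq_1)
    finally show ?thesis by (simp add: power_mult)
  qed
  have "\<Union>F \<subseteq> A \<times> A" using F pair_subset by blast
  then have "P \<le> (2 / card A) ^ card (\<Union>F)"
    unfolding P_def using finite_ground card A by (intro prob_extensions_le) auto
  moreover have "q \<le> (2 / card A) ^ (2 * j)"
    unfolding q_def using A by (intro fact_diff_div_fact_le) simp
  moreover have "0 \<le> P" "0 \<le> q" by (simp_all add: P_def q_def)
  ultimately have "\<bar>P - q\<bar> \<le> 4 ^ j * weight (\<Union>F)"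
    using weight_ge[OF order_refl card] weight_ge[OF card order_refl] by linarith
  then show ?thesis by (simp add: P_def q_def)
qed

lemma abs_binomial_moment_diff_le:
  assumes A: "4 * j \<le> card A"
  shows "\<bar>binomial_moment A E j - real (card E choose j) * (fact (card A - 2 * j) / fact (card A))\<bar>
    \<le> 4 ^ j * (real ((2 * j + 1) * K) ^ (j - 2) * (6 * real K ^ 2 / real (card A)))"
proof -
  define P where "P F = measure_pmf.prob (uniform_perm A) (extensions (\<Union>F))" for F
  define q :: real where "q = fact (card A - 2 * j) / fact (card A)"
  define S where "S = {F. F \<subseteq> E \<and> card F = j}"
  define B where "B = {F \<in> S. \<exists>e\<in>F. \<exists>e'\<in>F. e \<noteq> e' \<and> share_line e e'}"
  have finS: "finite S" using finite_family by (auto simp: S_def intro: finite_subset[of _ "Pow E"])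
  have separated: "P F = q" if "F \<in> S - B" for F
  proof -
    have "F \<subseteq> E" "card F = j" using that by (auto simp: S_def)
    moreover have "\<not> share_line e e'" if "e \<in> F" "e' \<in> F" "e \<noteq> e'" for e e'
      using that \<open>F \<in> S - B\<close> by (auto simp: B_def)
    ultimately show ?thesis using prob_extensions_separated[of F] by (simp add: P_def q_def)
  qed
  have "binomial_moment A E j - real (card E choose j) * q = (\<Sum>F\<in>S. P F - q)"
    using n_subsets[OF finite_family, of j]
    by (simp add: binomial_moment_def P_def S_def sum_subtractf)
  also have "\<dots> = (\<Sum>F\<in>B. P F - q)"
    using separated finS by (intro sum.mono_neutral_right) (auto simp: B_def)
  also have "\<bar>\<dots>\<bar> \<le> (\<Sum>F\<in>B. 4 ^ j * weight (\<Union>F))"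
    unfolding P_def q_def using A
    by (intro order_trans[OF sum_abs] sum_mono abs_prob_extensions_diff_le) (auto simp: B_def S_def)
  also have "\<dots> = 4 ^ j * (\<Sum>F\<in>B. weight (\<Union>F))" by (simp add: sum_distrib_left)
  also have "\<dots> \<le> 4 ^ j * (real ((2 * j + 1) * K) ^ (j - 2) * (6 * real K ^ 2 / real (card A)))"
    using sum_weight_share_line_subsets_le[of j]
    by (intro mult_left_mono) (simp_all add: B_def S_def conj_assoc)
  finally show ?thesis by (simp add: q_def)
qed

end

lemma binomial_moment_tendsto:
  fixes A :: "'i \<Rightarrow> 'a set"
  assumes family: "\<And>n. pair_family (A n) (E n) K"
    and ground: "filterlim (\<lambda>n. card (A n)) at_top F"
    and density: "((\<lambda>n. real (card (E n)) / real (card (A n)) ^ 2) \<longlongrightarrow> L) F"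
  shows "((\<lambda>n. binomial_moment (A n) (E n) j) \<longlongrightarrow> L ^ j / fact j) F"
proof -
  define \<gamma> where
    "\<gamma> n = real (card (E n) choose j) * (fact (card (A n) - 2 * j) / fact (card (A n)))" for n
  define C where "C = 4 ^ j * (real ((2 * j + 1) * K) ^ (j - 2) * (6 * real K ^ 2))"
  have "\<forall>\<^sub>F n in F. 4 * j \<le> card (A n)"
    using ground by (simp add: filterlim_at_top)
  then have "\<forall>\<^sub>F n in F. norm (binomial_moment (A n) (E n) j - \<gamma> n) \<le> C / card (A n)"
  proof eventually_elim
    case (elim n)
    then show ?case
      using pair_family.abs_binomial_moment_diff_le[OF family, of j n] by (simp add: \<gamma>_def C_def)
  qed
  moreover have "((\<lambda>n. C / card (A n)) \<longlongrightarrow> 0) F"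
    using filterlim_compose[OF filterlim_real_sequentially ground]
    by (intro tendsto_divide_0[OF tendsto_const] filterlim_at_top_imp_at_infinity)
  ultimately have "((\<lambda>n. binomial_moment (A n) (E n) j - \<gamma> n) \<longlongrightarrow> 0) F" by (rule Lim_null_comparison)
  moreover have "(\<gamma> \<longlongrightarrow> L ^ j / fact j) F"
    unfolding \<gamma>_def using ground density by (rule choose_times_fact_ratio_tendsto)
  ultimately show ?thesis using tendsto_add by fastforce
qed

lemma prob_avoid_pair_family_tendsto:
  fixes A :: "'i \<Rightarrow> 'a set"
  assumes family: "\<And>n. pair_family (A n) (E n) K"
    and ground: "filterlim (\<lambda>n. card (A n)) at_top F"
    and density: "((\<lambda>n. real (card (E n)) / real (card (A n)) ^ 2) \<longlongrightarrow> L) F"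
  shows "((\<lambda>n. measure_pmf.prob (uniform_perm (A n)) {\<pi>. \<forall>e\<in>E n. \<pi> \<notin> extensions e}) \<longlongrightarrow> exp (- L)) F"
proof -
  define X where "X n \<pi> = card {e \<in> E n. \<pi> \<in> extensions e}" for n and \<pi> :: "'a \<Rightarrow> 'a"
  have finE: "finite (E n)" and finA: "finite (A n)" for n
    using pair_family.finite_family[OF family] pair_family.finite_ground[OF family] by blast+
  have "((\<lambda>n. measure_pmf.prob (uniform_perm (A n)) {\<pi>. X n \<pi> = 0}) \<longlongrightarrow> exp (- L)) F"
  proof (rule prob_eq_0_tendsto_exp)
    show "integrable (uniform_perm (A n)) (\<lambda>\<pi>. real (X n \<pi> choose j))" for n j
      using finA by (rule integrable_uniform_perm)
    show "((\<lambda>n. measure_pmf.expectation (uniform_perm (A n)) (\<lambda>\<pi>. real (X n \<pi> choose j)))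
        \<longlongrightarrow> L ^ j / fact j) F" for j
      unfolding X_def expectation_choose_eq_binomial_moment[OF finE]
      using assms by (rule binomial_moment_tendsto)
  qed
  moreover have "X n \<pi> = 0 \<longleftrightarrow> (\<forall>e\<in>E n. \<pi> \<notin> extensions e)" for n \<pi>
    using finE by (auto simp: X_def)
  ultimately show ?thesis by simp
qed

subsection \<open>Close pairs of grid points\<close>

definition nat_dist :: "nat \<Rightarrow> nat \<Rightarrow> nat" where
  "nat_dist i j = nat \<bar>int i - int j\<bar>"

definition grid_dist :: "nat \<times> nat \<Rightarrow> nat \<times> nat \<Rightarrow> nat" where
  "grid_dist p q = nat_dist (fst p) (fst q) + nat_dist (snd p) (snd q)"

lemma nat_dist_commute: "nat_dist i j = nat_dist j i"
  by (simp add: nat_dist_def abs_minus_commute)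

lemma grid_dist_commute: "grid_dist p q = grid_dist q p"
  by (simp add: grid_dist_def nat_dist_commute)

lemma le_perm_dist_iff:
  assumes n: "n \<ge> 2"
  shows "k \<le> perm_dist n \<pi> \<longleftrightarrow>
    (\<forall>i\<in>{1..n}. \<forall>j\<in>{1..n}. i \<noteq> j \<longrightarrow> k \<le> grid_dist (i, \<pi> i) (j, \<pi> j))"
proof -
  define S where "S = {grid_dist (i, \<pi> i) (j, \<pi> j) | i j. i \<in> {1..n} \<and> j \<in> {1..n} \<and> i < j}"
  have "S \<subseteq> (\<lambda>(i, j). grid_dist (i, \<pi> i) (j, \<pi> j)) ` ({1..n} \<times> {1..n})" by (auto simp: S_def)
  then have "finite S" by (rule finite_subset) auto
  moreover have "grid_dist (1, \<pi> 1) (2, \<pi> 2) \<in> S" using n unfolding S_def by fastforce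
  moreover have "perm_dist n \<pi> = Min S"
    by (simp add: perm_dist_def S_def grid_dist_def nat_dist_def)
  ultimately have "k \<le> perm_dist n \<pi> \<longleftrightarrow> (\<forall>s\<in>S. k \<le> s)" by (metis Min_ge_iff empty_iff)
  also have "\<dots> \<longleftrightarrow> (\<forall>i\<in>{1..n}. \<forall>j\<in>{1..n}. i < j \<longrightarrow> k \<le> grid_dist (i, \<pi> i) (j, \<pi> j))"
    unfolding S_def by blast
  also have "\<dots> \<longleftrightarrow> (\<forall>i\<in>{1..n}. \<forall>j\<in>{1..n}. i \<noteq> j \<longrightarrow> k \<le> grid_dist (i, \<pi> i) (j, \<pi> j))"
    by (metis grid_dist_commute nat_neq_iff)
  finally show ?thesis .
qed

lemma perm_dist_le:
  assumes "n \<ge> 2" "i \<in> {1..n}" "j \<in> {1..n}" "i \<noteq> j"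
  shows "perm_dist n \<pi> \<le> grid_dist (i, \<pi> i) (j, \<pi> j)"
  using le_perm_dist_iff[of n "perm_dist n \<pi>" \<pi>] assms by blast

definition close_pairs :: "nat \<Rightarrow> nat \<Rightarrow> (nat \<times> nat) set set" where
  "close_pairs d n = {{p, q} | p q. p \<in> {1..n} \<times> {1..n} \<and> q \<in> {1..n} \<times> {1..n} \<and>
     fst p \<noteq> fst q \<and> snd p \<noteq> snd q \<and> grid_dist p q \<le> d + 1}"

lemma le_perm_dist_iff_no_close_pair:
  assumes n: "n \<ge> 2" and \<pi>: "\<pi> permutes {1..n}"
  shows "d + 2 \<le> perm_dist n \<pi> \<longleftrightarrow> (\<forall>e\<in>close_pairs d n. \<pi> \<notin> extensions e)"
proof (intro iffI ballI notI)
  fix e assume far: "d + 2 \<le> perm_dist n \<pi>" and e: "e \<in> close_pairs d n" "\<pi> \<in> extensions e"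
  then obtain p q where pq: "e = {p, q}" "fst p \<in> {1..n}" "fst q \<in> {1..n}" "fst p \<noteq> fst q"
    "grid_dist p q \<le> d + 1"
    by (auto simp: close_pairs_def)
  moreover have "p = (fst p, \<pi> (fst p))" "q = (fst q, \<pi> (fst q))"
    using e(2) pq(1) by (simp_all add: extensions_def)
  ultimately show False using far unfolding le_perm_dist_iff[OF n] by fastforce
next
  assume none: "\<forall>e\<in>close_pairs d n. \<pi> \<notin> extensions e"
  have "d + 2 \<le> grid_dist (i, \<pi> i) (j, \<pi> j)" if ij: "i \<in> {1..n}" "j \<in> {1..n}" "i \<noteq> j" for i j
  proof (rule ccontr)
    assume "\<not> ?thesis"
    moreover have "\<pi> i \<in> {1..n}" "\<pi> j \<in> {1..n}" "\<pi> i \<noteq> \<pi> j"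
      using ij permutes_in_image[OF \<pi>] permutes_inj[OF \<pi>] by (auto dest: injD)
    ultimately have "{(i, \<pi> i), (j, \<pi> j)} \<in> close_pairs d n"
      unfolding close_pairs_def using ij by fastforce
    moreover have "\<pi> \<in> extensions {(i, \<pi> i), (j, \<pi> j)}" by (simp add: extensions_def)
    ultimately show False using none by blast
  qed
  then show "d + 2 \<le> perm_dist n \<pi>" unfolding le_perm_dist_iff[OF n] by blast
qed

lemma card_close_pairs_through_le: "card {e \<in> close_pairs d n. p \<in> e} \<le> (2 * d + 3) ^ 2"
proof -
  define I where "I a = {a - (d + 1)..a + d + 1}" for a :: nat
  have "{e \<in> close_pairs d n. p \<in> e} \<subseteq> (\<lambda>q. {p, q}) ` (I (fst p) \<times> I (snd p))"
  proof
    fix e assume "e \<in> {e \<in> close_pairs d n. p \<in> e}"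
    then obtain a b where "e = {a, b}" "p \<in> {a, b}" "grid_dist a b \<le> d + 1"
      by (auto simp: close_pairs_def)
    then obtain q where "e = {p, q}" "grid_dist p q \<le> d + 1"
      by (metis grid_dist_commute insert_commute insertE singletonD)
    moreover from this have "q \<in> I (fst p) \<times> I (snd p)"
      by (auto simp: I_def mem_Times_iff grid_dist_def nat_dist_def)
    ultimately show "e \<in> (\<lambda>q. {p, q}) ` (I (fst p) \<times> I (snd p))" by blast
  qed
  then have "card {e \<in> close_pairs d n. p \<in> e} \<le> card (I (fst p) \<times> I (snd p))"
    by (intro surj_card_le) (auto simp: I_def)
  also have "\<dots> = card (I (fst p)) * card (I (snd p))" by (rule card_cartesian_product)
  also have "\<dots> \<le> (2 * d + 3) * (2 * d + 3)" by (intro mult_mono) (auto simp: I_def)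
  finally show ?thesis by (simp add: power2_eq_square)
qed

lemma pair_family_close_pairs: "pair_family {1..n} (close_pairs d n) ((2 * d + 3) ^ 2)"
proof
  show "card {e \<in> close_pairs d n. p \<in> e} \<le> (2 * d + 3) ^ 2" for p
    by (rule card_close_pairs_through_le)
qed (auto simp: close_pairs_def partial_perm_def card_2_iff)

text \<open>A diagonal of the rectangle with lower left corner (i, u), width r and height s.\<close>

definition diagonal :: "(nat \<times> nat) \<times> bool \<Rightarrow> nat \<times> nat \<Rightarrow> (nat \<times> nat) set" where
  "diagonal = (\<lambda>((r, s), rising) (i, u).
     if rising then {(i, u), (i + r, u + s)} else {(i, u + s), (i + r, u)})"

definition shapes :: "nat \<Rightarrow> (nat \<times> nat) set" where
  "shapes d = (SIGMA r:{1..d}. {1..d + 1 - r})"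

lemma mem_shapes_iff: "(r, s) \<in> shapes d \<longleftrightarrow> 1 \<le> r \<and> 1 \<le> s \<and> r + s \<le> d + 1"
  by (auto simp: shapes_def)

lemma card_shapes: "real (card (shapes d)) = (real d ^ 2 + real d) / 2"
proof -
  have "card (shapes d) = (\<Sum>r=1..d. d + 1 - r)" by (simp add: shapes_def)
  also have "\<dots> = (\<Sum>r=1..d. r)"
    by (rule sum.reindex_bij_witness[of _ "\<lambda>r. d + 1 - r" "\<lambda>r. d + 1 - r"]) auto
  also have "real \<dots> = (real d ^ 2 + real d) / 2"
    by (induction d) (auto simp: field_simps power2_eq_square)
  finally show ?thesis .
qed

definition diagonal_params :: "nat \<Rightarrow> nat \<Rightarrow> (((nat \<times> nat) \<times> bool) \<times> nat \<times> nat) set" where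
  "diagonal_params d n = (SIGMA x:shapes d \<times> UNIV. {1..n - fst (fst x)} \<times> {1..n - snd (fst x)})"

lemma inj_on_diagonal: "inj_on (case_prod diagonal) (diagonal_params d n)"
proof (rule inj_onI)
  fix x y assume xy: "x \<in> diagonal_params d n" "y \<in> diagonal_params d n"
    "case_prod diagonal x = case_prod diagonal y"
  obtain r s b i u where x: "x = (((r, s), b), (i, u))" by (metis surj_pair)
  obtain r' s' b' i' u' where y: "y = (((r', s'), b'), (i', u'))" by (metis surj_pair)
  have "r \<ge> 1" "s \<ge> 1" "r' \<ge> 1" "s' \<ge> 1"
    using xy by (auto simp: x y diagonal_params_def mem_shapes_iff)
  then show "x = y"
    using xy(3) unfolding x y diagonal_def
    by (cases b; cases b'; simp add: doubleton_eq_iff; linarith?)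
qed

lemma close_pair_is_diagonal:
  assumes pq: "p \<in> {1..n} \<times> {1..n}" "q \<in> {1..n} \<times> {1..n}" "fst p < fst q" "snd p \<noteq> snd q"
    and close: "grid_dist p q \<le> d + 1"
  shows "{p, q} \<in> case_prod diagonal ` diagonal_params d n"
proof -
  define x where "x = (((fst q - fst p, nat_dist (snd p) (snd q)), snd p < snd q),
    (fst p, min (snd p) (snd q)))"
  have "x \<in> diagonal_params d n"
    using pq close
    by (auto simp: x_def diagonal_params_def mem_shapes_iff grid_dist_def nat_dist_def
        mem_Times_iff)
  moreover have "{p, q} = case_prod diagonal x"
    using pq by (auto simp: x_def diagonal_def nat_dist_def prod_eq_iff)
  ultimately show ?thesis by blast
qed

lemma diagonal_is_close_pair:
  assumes "x \<in> diagonal_params d n"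
  shows "case_prod diagonal x \<in> close_pairs d n"
proof -
  obtain r s b i u where x: "x = (((r, s), b), (i, u))" by (metis surj_pair)
  define p q where "p = (i, if b then u else u + s)" and "q = (i + r, if b then u + s else u)"
  have "p \<in> {1..n} \<times> {1..n}" "q \<in> {1..n} \<times> {1..n}" "fst p \<noteq> fst q" "snd p \<noteq> snd q"
    "grid_dist p q \<le> d + 1"
    using assms
    by (auto simp: x p_def q_def diagonal_params_def mem_shapes_iff grid_dist_def nat_dist_def)
  moreover have "case_prod diagonal x = {p, q}" by (simp add: x diagonal_def p_def q_def)
  ultimately show ?thesis unfolding close_pairs_def by blast
qed

lemma close_pairs_eq_diagonals: "close_pairs d n = case_prod diagonal ` diagonal_params d n"
proof (intro equalityI subsetI)
  fix e assume "e \<in> close_pairs d n"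
  then obtain p q where pq: "e = {p, q}" "p \<in> {1..n} \<times> {1..n}" "q \<in> {1..n} \<times> {1..n}"
    "fst p \<noteq> fst q" "snd p \<noteq> snd q" "grid_dist p q \<le> d + 1"
    unfolding close_pairs_def by blast
  consider (ordered) "fst p < fst q" | (swapped) "fst q < fst p" using pq(4) by linarith
  then show "e \<in> case_prod diagonal ` diagonal_params d n"
  proof cases
    case ordered
    then show ?thesis using close_pair_is_diagonal[of p n q d] pq by simp
  next
    case swapped
    then show ?thesis
      using close_pair_is_diagonal[of q n p d] pq by (simp add: grid_dist_commute insert_commute)
  qed
qed (use diagonal_is_close_pair in blast)

lemma card_close_pairs: "card (close_pairs d n) = (\<Sum>(r, s)\<in>shapes d. 2 * ((n - r) * (n - s)))"
proof -
  have "card (close_pairs d n) = card (diagonal_params d n)"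
    by (simp add: close_pairs_eq_diagonals card_image inj_on_diagonal)
  also have "\<dots> = (\<Sum>x\<in>shapes d \<times> (UNIV :: bool set). (n - fst (fst x)) * (n - snd (fst x)))"
    unfolding diagonal_params_def
    by (subst card_SigmaI) (auto simp: shapes_def card_cartesian_product)
  also have "\<dots> = (\<Sum>y\<in>shapes d. \<Sum>b\<in>(UNIV :: bool set). (n - fst y) * (n - snd y))"
    by (subst sum.cartesian_product) (simp add: case_prod_unfold)
  also have "\<dots> = (\<Sum>(r, s)\<in>shapes d. 2 * ((n - r) * (n - s)))"
    by (simp add: case_prod_unfold)
  finally show ?thesis .
qed

lemma card_close_pairs_density:
  "(\<lambda>n. real (card (close_pairs d n)) / real n ^ 2) \<longlonglongrightarrow> real d ^ 2 + real d"
proof -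
  have "(\<lambda>n. real (n - r) / real n) \<longlonglongrightarrow> 1" for r
  proof (rule Lim_transform_eventually)
    show "(\<lambda>n. (real n - real r) / real n) \<longlonglongrightarrow> 1" by real_asymp
    show "\<forall>\<^sub>F n in sequentially. (real n - real r) / real n = real (n - r) / real n"
      using eventually_ge_at_top[of r] by eventually_elim (simp add: of_nat_diff)
  qed
  then have "(\<lambda>n. \<Sum>x\<in>shapes d. 2 * (real (n - fst x) / real n * (real (n - snd x) / real n)))
      \<longlonglongrightarrow> (\<Sum>x\<in>shapes d. 2 * (1 * 1))"
    by (intro tendsto_intros)
  moreover have "(\<Sum>x\<in>shapes d. 2 * (1 * 1)) = real d ^ 2 + real d"
    by (simp add: card_shapes)
  moreover have "real (card (close_pairs d n)) / real n ^ 2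
      = (\<Sum>x\<in>shapes d. 2 * (real (n - fst x) / real n * (real (n - snd x) / real n)))" for n
    by (simp add: card_close_pairs case_prod_unfold sum_divide_distrib power2_eq_square)
  ultimately show ?thesis by simp
qed

definition Yn_pmf :: "nat \<Rightarrow> nat pmf" where
  "Yn_pmf n = map_pmf (perm_dist n) (uniform_perm {1..n})"

lemma prob_Yn_ge:
  "measure_pmf.prob (Yn_pmf n) {k..}
    = real (card {\<pi> \<in> perms {1..n}. k \<le> perm_dist n \<pi>}) / fact n"
  by (simp add: Yn_pmf_def prob_uniform_perm vimage_def Int_def)

lemma prob_Yn_ge_tendsto:
  "(\<lambda>n. measure_pmf.prob (Yn_pmf n) {d + 2..}) \<longlonglongrightarrow> exp (- (real d ^ 2) - real d)"
proof -
  have "(\<lambda>n. measure_pmf.prob (uniform_perm {1..n}) {\<pi>. \<forall>e\<in>close_pairs d n. \<pi> \<notin> extensions e})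
      \<longlonglongrightarrow> exp (- (real d ^ 2 + real d))"
    by (rule prob_avoid_pair_family_tendsto)
       (use pair_family_close_pairs card_close_pairs_density filterlim_ident in auto)
  moreover have "\<forall>\<^sub>F n in sequentially.
      measure_pmf.prob (uniform_perm {1..n}) {\<pi>. \<forall>e\<in>close_pairs d n. \<pi> \<notin> extensions e}
      = measure_pmf.prob (Yn_pmf n) {d + 2..}"
    using eventually_ge_at_top[of 2]
  proof eventually_elim
    case (elim n)
    have "perms {1..n} \<inter> {\<pi>. \<forall>e\<in>close_pairs d n. \<pi> \<notin> extensions e}
        = {\<pi> \<in> perms {1..n}. d + 2 \<le> perm_dist n \<pi>}"
      using le_perm_dist_iff_no_close_pair[OF elim] by blast
    then show ?case by (simp add: prob_uniform_perm prob_Yn_ge)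
  qed
  ultimately show ?thesis using Lim_transform_eventually by fastforce
qed

subsection \<open>Exponential tail bound\<close>

lemma card_same_fibre_ge:
  assumes R: "finite R" and B: "finite B" "f ` R \<subseteq> B"
  shows "real (card R) ^ 2 \<le> real (card {(u, v) \<in> R \<times> R. f u = f v}) * real (card B)"
proof -
  define x where "x b = real (card {u \<in> R. f u = b})" for b
  have "(\<Sum>b\<in>B. x b) = (\<Sum>b\<in>B. \<Sum>u | u \<in> R \<and> f u = b. 1)" by (simp add: x_def)
  also have "\<dots> = (\<Sum>u\<in>R. 1)" using R B by (rule sum.group)
  finally have "real (card R) ^ 2 = (\<Sum>b\<in>B. x b) ^ 2" by simp
  also have "\<dots> \<le> (\<Sum>b\<in>B. x b ^ 2) * real (card B)" by (rule sum_squared_le_sum_of_squares)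
  also have "(\<Sum>b\<in>B. x b ^ 2) = (\<Sum>b\<in>B. \<Sum>u | u \<in> R \<and> f u = b. x (f u))"
    by (intro sum.cong) (auto simp: x_def power2_eq_square)
  also have "\<dots> = (\<Sum>u\<in>R. x (f u))" using R B by (rule sum.group)
  also have "\<dots> = real (card (SIGMA u:R. {v \<in> R. f v = f u}))" using R by (simp add: x_def)
  also have "(SIGMA u:R. {v \<in> R. f v = f u}) = {(u, v) \<in> R \<times> R. f u = f v}" by auto
  finally show ?thesis .
qed

definition far_pairs :: "nat \<Rightarrow> nat set \<Rightarrow> (nat \<times> nat) set" where
  "far_pairs d R = {p \<in> R \<times> R. d < nat_dist (fst p) (snd p)}"

lemma card_same_block_ge:
  assumes R: "R \<subseteq> {1..n}" "n \<le> 2 * card R" and D: "0 < D" "D \<le> n"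
  shows "real D * real (card R) \<le> 4 * real (card {(u, v) \<in> R \<times> R. u div D = v div D})"
proof -
  define S where "S = {(u, v) \<in> R \<times> R. u div D = v div D}"
  define B where "B = {..n div D}"
  have finR: "finite R" using R(1) by (rule finite_subset) simp
  have "real (n div D) \<le> real n / real D" by (rule of_nat_div_le_of_nat)
  moreover have "1 \<le> real n / real D" using D by simp
  ultimately have "real (card B) \<le> 2 * real n / real D" by (simp add: B_def)
  then have "real D * real (card B) \<le> 2 * real n" using D by (simp add: field_simps)
  then have cardB: "real D * real (card B) \<le> 4 * real (card R)" using R(2) by simp
  have "real (card R) ^ 2 \<le> real (card S) * real (card B)"
    unfolding S_def
    by (rule card_same_fibre_ge) (use finR R in \<open>auto simp: B_def intro!: div_le_mono\<close>)
  then have "real D * real (card R) ^ 2 \<le> real D * (real (card S) * real (card B))"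
    by (intro mult_left_mono) auto
  also have "\<dots> = real (card S) * (real D * real (card B))" by simp
  also have "\<dots> \<le> real (card S) * (4 * real (card R))" using cardB by (intro mult_left_mono) auto
  finally have "real (card R) * (real D * real (card R)) \<le> real (card R) * (4 * real (card S))"
    by (simp add: power2_eq_square mult_ac)
  moreover have "0 < real (card R)" using R(2) D by simp
  ultimately show ?thesis by (simp add: S_def mult_le_cancel_left)
qed

lemma nat_dist_same_block_less:
  assumes "u div D = v div D" and "0 < D"
  shows "nat_dist u v < D"
proof -
  define b where "b = D * (u div D)"
  have "u = b + u mod D" "v = b + v mod D"
    using assms(1) unfolding b_def by (metis mult_div_mod_eq)+
  moreover have "u mod D < D" "v mod D < D" using assms(2) by simp_all
  ultimately show ?thesis unfolding nat_dist_def by linarith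
qed

lemma card_far_pairs_le:
  assumes R: "R \<subseteq> {1..n}" "n \<le> 2 * card R" and d: "7 \<le> d" "d < n"
  shows "real (card (far_pairs d R))
    \<le> (1 - (real d + 1) / (8 * real n)) * (real (card R) * (real (card R) - 1))"
proof -
  define D m N where "D = real d + 1" and "m = real (card R)" and "N = real n"
  have finR: "finite R" and "card R \<le> n"
    using R card_mono[of "{1..n}" R] by (auto intro: finite_subset)
  then have m: "N / 2 \<le> m" "m \<le> N" and D: "8 \<le> D" "D \<le> N"
    using R d by (auto simp: m_def N_def D_def)
  define S where "S = {(u, v) \<in> R \<times> R. u div (d + 1) = v div (d + 1)}"
  have sub: "S \<subseteq> R \<times> R" by (auto simp: S_def)
  then have finS: "finite S" using finR by (auto intro: finite_subset)
  have "far_pairs d R \<subseteq> R \<times> R - S"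
    using nat_dist_same_block_less[of _ "d + 1"] by (fastforce simp: far_pairs_def S_def)
  then have "card (far_pairs d R) \<le> card (R \<times> R - S)" using finR by (intro card_mono) auto
  also have "real \<dots> = m ^ 2 - real (card S)"
    using finR finS sub card_mono[of "R \<times> R" S]
    by (simp add: m_def card_Diff_subset card_cartesian_product of_nat_diff power2_eq_square)
  also have "\<dots> \<le> m ^ 2 - m * D / 4"
    using card_same_block_ge[OF R, of "d + 1"] d by (simp add: S_def m_def D_def algebra_simps)
  also have "\<dots> \<le> (1 - D / (8 * N)) * (m * (m - 1))"
  proof -
    have "D / (8 * N) * (m - 1) \<le> D / (8 * N) * N" using m D by (intro mult_left_mono) auto
    then have "D / (8 * N) * (m - 1) \<le> D / 8" using D by simp
    then have "m * (m - D / 4) \<le> m * ((1 - D / (8 * N)) * (m - 1))"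
      using m D by (intro mult_left_mono) (auto simp: left_diff_distrib)
    then show ?thesis by (simp add: algebra_simps power2_eq_square)
  qed
  finally show ?thesis by (simp add: D_def m_def N_def)
qed

definition spread :: "nat \<Rightarrow> nat \<Rightarrow> (nat \<Rightarrow> nat) set" where
  "spread d t = {\<pi>. \<forall>s<t. d < nat_dist (\<pi> (2 * s + 1)) (\<pi> (2 * s + 2))}"

lemma spread_Suc_subset:
  assumes free: "{2 * t + 1, 2 * t + 2} \<subseteq> {1..n} - fst ` V"
  shows "perms {1..n} \<inter> extensions V \<inter> spread d (Suc t)
    \<subseteq> (\<Union>p\<in>far_pairs d ({1..n} - snd ` V).
      perms {1..n} \<inter> extensions (insert (2 * t + 1, fst p) (insert (2 * t + 2, snd p) V))
        \<inter> spread d t)"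
proof
  fix \<pi> assume \<pi>: "\<pi> \<in> perms {1..n} \<inter> extensions V \<inter> spread d (Suc t)"
  define p where "p = (\<pi> (2 * t + 1), \<pi> (2 * t + 2))"
  have "fst p \<in> {1..n} - snd ` V" "snd p \<in> {1..n} - snd ` V"
    unfolding p_def prod.sel by (rule permutes_extension_unused; use \<pi> free in auto)+
  then have "p \<in> far_pairs d ({1..n} - snd ` V)"
    using \<pi> by (simp add: far_pairs_def spread_def p_def)
  moreover have
    "\<pi> \<in> extensions (insert (2 * t + 1, fst p) (insert (2 * t + 2, snd p) V)) \<inter> spread d t"
    using \<pi> by (auto simp: extensions_def spread_def p_def)
  ultimately show "\<pi> \<in> (\<Union>p\<in>far_pairs d ({1..n} - snd ` V).
      perms {1..n} \<inter> extensions (insert (2 * t + 1, fst p) (insert (2 * t + 2, snd p) V))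
        \<inter> spread d t)"
    using \<pi> by blast
qed

lemma card_spread_Suc_extensions_le:
  assumes V: "partial_perm {1..n} V" "2 * card V \<le> n"
    and free: "{2 * t + 1, 2 * t + 2} \<subseteq> {1..n} - fst ` V"
    and d: "7 \<le> d" "d < n" and b: "0 \<le> b"
    and card_le: "\<And>p. p \<in> far_pairs d ({1..n} - snd ` V) \<Longrightarrow>
      real (card (perms {1..n}
        \<inter> extensions (insert (2 * t + 1, fst p) (insert (2 * t + 2, snd p) V)) \<inter> spread d t)) \<le> b"
  shows "real (card (perms {1..n} \<inter> extensions V \<inter> spread d (Suc t)))
    \<le> (1 - (real d + 1) / (8 * real n)) * (real (n - card V) * (real (n - card V) - 1)) * b"
proof -
  define R where "R = {1..n} - snd ` V"
  define G where "G p = perms {1..n}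
    \<inter> extensions (insert (2 * t + 1, fst p) (insert (2 * t + 2, snd p) V)) \<inter> spread d t" for p
  have cardR: "card R = n - card V" using V(1) by (simp add: R_def card_unused_values)
  then have R: "R \<subseteq> {1..n}" "n \<le> 2 * card R" using V(2) by (auto simp: R_def)
  have finR: "finite (far_pairs d R)"
    by (rule finite_subset[of _ "R \<times> R"]) (auto simp: far_pairs_def R_def)
  have finG: "finite (\<Union>p\<in>far_pairs d R. G p)"
    by (rule finite_subset[of _ "perms {1..n}"]) (auto simp: G_def finite_permutations)
  have "card (perms {1..n} \<inter> extensions V \<inter> spread d (Suc t)) \<le> card (\<Union>p\<in>far_pairs d R. G p)"
    using finG spread_Suc_subset[OF free] unfolding G_def R_def by (rule card_mono)
  also have "\<dots> \<le> (\<Sum>p\<in>far_pairs d R. card (G p))" using finR by (rule card_UN_le)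
  also have "real \<dots> \<le> (\<Sum>p\<in>far_pairs d R. b)"
    unfolding of_nat_sum by (rule sum_mono) (use card_le in \<open>simp add: G_def R_def\<close>)
  also have "\<dots> \<le> (1 - (real d + 1) / (8 * real n)) * (real (card R) * (real (card R) - 1)) * b"
    unfolding sum_constant using R d b by (intro mult_right_mono card_far_pairs_le)
  finally show ?thesis by (simp add: cardR)
qed

lemma card_spread_extensions_le:
  assumes "partial_perm {1..n} V" and "fst ` V \<inter> {1..2 * t} = {}"
    and "2 * (card V + 2 * t) \<le> n" and d: "7 \<le> d" "d < n"
  shows "real (card (perms {1..n} \<inter> extensions V \<inter> spread d t))
    \<le> (1 - (real d + 1) / (8 * real n)) ^ t * fact (n - card V)"
  using assms(1-3)
proof (induction t arbitrary: V)
  case 0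
  then show ?case using card_perm_extensions[of "{1..n}" V] by (simp add: spread_def)
next
  case (Suc t)
  define c where "c = 1 - (real d + 1) / (8 * real n)"
  define k where "k = n - card V - 2"
  have k: "n - card V = k + 2" using Suc.prems(3) by (simp add: k_def)
  have free: "2 * t + 1 \<in> {1..n} - fst ` V" "2 * t + 2 \<in> {1..n} - fst ` V"
    using Suc.prems(2,3) by auto
  have "real (card (perms {1..n} \<inter> extensions V \<inter> spread d (Suc t)))
      \<le> c * (real (n - card V) * (real (n - card V) - 1)) * (c ^ t * fact k)"
    unfolding c_def
  proof (rule card_spread_Suc_extensions_le)
    fix p assume p: "p \<in> far_pairs d ({1..n} - snd ` V)"
    define U where "U = insert (2 * t + 2, snd p) V"
    define W where "W = insert (2 * t + 1, fst p) U"
    have unused: "fst p \<in> {1..n} - snd ` V" "snd p \<in> {1..n} - snd ` V" "fst p \<noteq> snd p"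
      using p by (simp_all add: far_pairs_def mem_Times_iff) (auto simp: nat_dist_def)
    have U: "partial_perm {1..n} U" "card U = card V + 1"
      unfolding U_def using partial_perm_insert[OF _ Suc.prems(1) free(2) unused(2)] by auto
    have "2 * t + 1 \<in> {1..n} - fst ` U" "fst p \<in> {1..n} - snd ` U"
      using free unused by (auto simp: U_def)
    then have W: "partial_perm {1..n} W" "card W = card V + 2"
      unfolding W_def using partial_perm_insert[OF _ U(1)] U(2) by auto
    moreover have "fst ` W \<inter> {1..2 * t} = {}" using Suc.prems(2) by (auto simp: W_def U_def)
    moreover have "n - card W = k" using W(2) by (simp add: k_def)
    ultimately show "real (card (perms {1..n} \<inter> extensions
        (insert (2 * t + 1, fst p) (insert (2 * t + 2, snd p) V)) \<inter> spread d t))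
      \<le> (1 - (real d + 1) / (8 * real n)) ^ t * fact k"
      using Suc.IH[of W] Suc.prems(3) unfolding W_def U_def by simp
  qed (use Suc.prems free d in \<open>auto simp: field_simps\<close>)
  also have "\<dots> = c ^ Suc t * fact (n - card V)"
    unfolding k by (simp add: algebra_simps)
  finally show ?case by (simp add: c_def)
qed

lemma prob_Yn_ge_exp_bound:
  assumes d: "7 \<le> d" "d < n"
  shows "measure_pmf.prob (Yn_pmf n) {d + 2..} \<le> exp (- (real d + 1) / 64)"
proof -
  define q where "q = (real d + 1) / (8 * real n)"
  define t where "t = n div 4"
  have q: "0 \<le> q" "q \<le> 1" using d by (auto simp: q_def field_simps)
  have "d < nat_dist (\<pi> (2 * s + 1)) (\<pi> (2 * s + 2))" if "d + 2 \<le> perm_dist n \<pi>" "s < t" for \<pi> s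
  proof -
    have "perm_dist n \<pi> \<le> grid_dist (2 * s + 1, \<pi> (2 * s + 1)) (2 * s + 2, \<pi> (2 * s + 2))"
      using that(2) d by (intro perm_dist_le) (auto simp: t_def)
    then show ?thesis using that(1) by (simp add: grid_dist_def nat_dist_def)
  qed
  then have "{\<pi> \<in> perms {1..n}. d + 2 \<le> perm_dist n \<pi>} \<subseteq> perms {1..n} \<inter> extensions {} \<inter> spread d t"
    by (auto simp: spread_def extensions_def)
  then have "card {\<pi> \<in> perms {1..n}. d + 2 \<le> perm_dist n \<pi>}
      \<le> card (perms {1..n} \<inter> extensions {} \<inter> spread d t)"
    by (intro card_mono) (simp_all add: finite_permutations)
  also have "real \<dots> \<le> (1 - q) ^ t * fact n"
    using card_spread_extensions_le[of n "{}" t d] d by (simp add: q_def t_def partial_perm_def)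
  finally have "measure_pmf.prob (Yn_pmf n) {d + 2..} \<le> (1 - q) ^ t"
    by (simp add: prob_Yn_ge divide_le_eq)
  also have "\<dots> \<le> exp (- q) ^ t"
    using q exp_ge_add_one_self[of "- q"] by (intro power_mono) auto
  also have "\<dots> = exp (- (q * real t))" by (simp add: exp_of_nat_mult[symmetric] mult.commute)
  also have "\<dots> \<le> exp (- (real d + 1) / 64)"
  proof -
    have "n \<le> 8 * t" using d unfolding t_def by presburger
    then have "q * real n \<le> q * real (8 * t)" using q by (intro mult_left_mono) auto
    moreover have "q * real n = (real d + 1) / 8" using d by (simp add: q_def)
    ultimately show ?thesis by simp
  qed
  finally show ?thesis .
qed

lemma prob_Yn_ge_eq_0:
  assumes n: "2 \<le> n" and k: "n < k"
  shows "measure_pmf.prob (Yn_pmf n) {k..} = 0"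
proof -
  have "\<not> k \<le> perm_dist n \<pi>" if \<pi>: "\<pi> permutes {1..n}" for \<pi>
  proof -
    have "\<pi> 1 \<in> {1..n}" "\<pi> 2 \<in> {1..n}" using permutes_in_image[OF \<pi>] n by simp_all
    then have "grid_dist (1, \<pi> 1) (2, \<pi> 2) \<le> n" by (auto simp: grid_dist_def nat_dist_def)
    moreover have "perm_dist n \<pi> \<le> grid_dist (1, \<pi> 1) (2, \<pi> 2)"
      using n by (intro perm_dist_le) auto
    ultimately show ?thesis using k by linarith
  qed
  then have "{\<pi> \<in> perms {1..n}. k \<le> perm_dist n \<pi>} = {}" by blast
  then show ?thesis by (simp only: prob_Yn_ge card.empty of_nat_0 div_0)
qed

lemma prob_Yn_ge_le:
  assumes n: "2 \<le> n"
  shows "measure_pmf.prob (Yn_pmf n) {k..} \<le> exp (1 - 1 / 64 * real k)"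
proof -
  consider (above) "n < k" | (small) "k < 9" | (middle) "9 \<le> k" "k \<le> n" by linarith
  then show ?thesis
  proof cases
    case above
    then show ?thesis using prob_Yn_ge_eq_0[OF n] by simp
  next
    case small
    then have "1 \<le> exp (1 - 1 / 64 * real k)" by simp
    then show ?thesis using measure_pmf.prob_le_1[of "Yn_pmf n" "{k..}"] by linarith
  next
    case middle
    define d where "d = k - 2"
    then have d: "k = d + 2" using middle by simp
    then have "measure_pmf.prob (Yn_pmf n) {k..} \<le> exp (- (real d + 1) / 64)"
      using middle unfolding d by (intro prob_Yn_ge_exp_bound) auto
    also have "\<dots> \<le> exp (1 - 1 / 64 * real k)" by (simp add: d field_simps)
    finally show ?thesis .
  qed
qed

subsection \<open>Convergence of moments\<close>

definition Y_tail :: "nat \<Rightarrow> real" where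
  "Y_tail k = (if k < 2 then 1 else exp (- (real (k - 2) ^ 2) - real (k - 2)))"

lemma Y_tail_add_2: "Y_tail (d + 2) = exp (- (real d ^ 2) - real d)"
  by (simp add: Y_tail_def)

lemma Y_pmf_eq_tail_diff: "Y_pmf k = Y_tail k - Y_tail (Suc k)"
proof -
  consider "k = 0" | "k = 1" | (ge_2) "k \<ge> 2" by linarith
  then show ?thesis
  proof cases
    case ge_2
    then have "Suc k - 2 = k - 1" by simp
    then show ?thesis using ge_2 by (simp add: Y_pmf_def Y_tail_def)
  qed (simp_all add: Y_pmf_def Y_tail_def)
qed

lemma prob_Yn_ge_eq_1:
  assumes n: "2 \<le> n" and k: "k \<le> 2"
  shows "measure_pmf.prob (Yn_pmf n) {k..} = 1"
proof -
  have "close_pairs 0 n = {}" by (auto simp: close_pairs_def grid_dist_def nat_dist_def)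
  then have "2 \<le> perm_dist n \<pi>" if "\<pi> permutes {1..n}" for \<pi>
    using le_perm_dist_iff_no_close_pair[OF n that, of 0] by simp
  then have "{\<pi> \<in> perms {1..n}. k \<le> perm_dist n \<pi>} = perms {1..n}" using k by fastforce
  then show ?thesis using card_permutations[of "{1..n}" n] by (simp add: prob_Yn_ge)
qed

lemma prob_Yn_ge_tendsto_Y_tail: "(\<lambda>n. measure_pmf.prob (Yn_pmf n) {k..}) \<longlonglongrightarrow> Y_tail k"
proof (cases "k < 2")
  case True
  have "\<forall>\<^sub>F n in sequentially. measure_pmf.prob (Yn_pmf n) {k..} = 1"
    using eventually_ge_at_top[of 2]
    by eventually_elim (use True in \<open>simp add: prob_Yn_ge_eq_1\<close>)
  then show ?thesis using True by (simp add: Y_tail_def tendsto_eventually)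
next
  case False
  then have "k = (k - 2) + 2" by simp
  then show ?thesis using prob_Yn_ge_tendsto[of "k - 2"] Y_tail_add_2[of "k - 2"] by simp
qed

lemma moment_Yn_eq_expectation:
  "moment_Yn a n = measure_pmf.expectation (Yn_pmf n) (\<lambda>k. real k ^ a)"
  by (simp add: moment_Yn_def Yn_pmf_def uniform_perm_def finite_permutations
      integral_pmf_of_set[OF perms_nonempty])

lemma moment_Yn_tendsto: "(\<lambda>n. moment_Yn a n) \<longlonglongrightarrow> moment_Y a"
  unfolding moment_Yn_eq_expectation moment_Y_def Y_pmf_eq_tail_diff
proof (rule expectation_tendsto_of_tails)
  show "sequentially \<noteq> bot" by (rule sequentially_bot)
  show "\<forall>\<^sub>F n in sequentially. \<forall>k. measure_pmf.prob (Yn_pmf n) {k..} \<le> exp (1 - 1 / 64 * real k)"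
    using eventually_ge_at_top[of 2] by eventually_elim (intro allI prob_Yn_ge_le)
  show "summable (\<lambda>k. \<bar>real k ^ a\<bar> * exp (1 - 1 / 64 * real k))"
    using summable_power_times_exp[of "1 / 64" a 1] by simp
qed (rule prob_Yn_ge_tendsto_Y_tail)

lemma summable_power_times_Y_tail: "summable (\<lambda>k. real k ^ a * Y_tail k)"
proof (rule summable_comparison_test')
  show "summable (\<lambda>k. real k ^ a * exp (1 - 1 / 64 * real k))"
    by (rule summable_power_times_exp) simp
  fix k :: nat
  have "Y_tail k \<le> exp (1 - 1 / 64 * real k)"
    using prob_Yn_ge_le by (blast intro: LIMSEQ_le_const2[OF prob_Yn_ge_tendsto_Y_tail])
  moreover have "Y_tail k \<ge> 0" by (simp add: Y_tail_def)
  ultimately show "norm (real k ^ a * Y_tail k) \<le> real k ^ a * exp (1 - 1 / 64 * real k)"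
    by (simp add: abs_mult mult_left_mono)
qed

lemma moment_Y_1: "moment_Y 1 = 1 + (\<Sum>d. exp (- (real d ^ 2) - real d))"
proof -
  have summable: "summable Y_tail" using summable_power_times_Y_tail[of 0] by simp
  have "(\<lambda>k. real k * Y_tail k) \<longlonglongrightarrow> 0"
    using summable_LIMSEQ_zero[OF summable_power_times_Y_tail[of 1]] by simp
  then have "(\<lambda>k. real k * (Y_tail k - Y_tail (Suc k))) sums (\<Sum>k. Y_tail (Suc k))"
    by (rule sums_times_decrement[OF summable])
  then have "moment_Y 1 = (\<Sum>k. Y_tail (Suc k))"
    by (simp add: moment_Y_def Y_pmf_eq_tail_diff sums_iff)
  also have "\<dots> = Y_tail 1 + (\<Sum>d. Y_tail (d + 2))"
    using summable suminf_split_head[of "\<lambda>k. Y_tail (Suc k)"] by (simp add: summable_Suc_iff)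
  also have "\<dots> = 1 + (\<Sum>d. exp (- (real d ^ 2) - real d))"
    by (simp add: Y_tail_def)
  finally show ?thesis .
qed

theorem theorem3:
  fixes a :: nat
  shows "((\<lambda>n. moment_Yn a n) \<longlonglongrightarrow> moment_Y a) \<and>
         ((\<lambda>n. moment_Yn 1 n) \<longlonglongrightarrow> 1 + (\<Sum>d. exp (- ((real d)^2) - real d)))"
  using moment_Yn_tendsto[of a] moment_Yn_tendsto[of 1] by (simp only: moment_Y_1)

end
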